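(* Let $p\ge2$ be an integer, $\mu_p=\mathbf{E}Z_1^p$, and for $N\ge 1$ let $$S_{N,p}(Z)=\frac{2^{pHN}}{2^{[N^\gamma]}}\sum_{l=1}^{2^{[N^\gamma]}}(\Delta Z_{l,N})^p.$$ Then $S_{N,p}(Z)\to\mu_p$ in $L^1(\Omega)$ as $N\to\infty$.
   Context: Fix an integer $q\ge1$ and $H\in(1/2,1)$. Let $(B(y))_{y\in\mathbb{R}}$ be a two-sided standard Brownian motion and $I_q$ the multiple Wiener-Itô integral of order $q$ with respect to $B$ (so $\mathbf{E}I_q(f)^2=q!\|f\|^2_{L^2(\mathbb{R}^q)}$ for symmetric $f$). For $u\ge 0$ put $f_u(y_1,\dots,y_q)=d(q,H)\prod_{i=1}^q(u-y_i)_+^{-(\frac12+\frac{1-H}{q})}$, where $x_+^a=x^a$ if $x>0$ and $0$ otherwise. The Hermite process of order $q$ and self-similarity index $H$ is $Z_t=I_q\left(\int_0^t f_u\,du\right)$, $t\ge0$, with $d(q,H)>0$ the constant such that $\mathbf{E}Z_t^2=t^{2H}$ for all $t\ge 0$. $[x]$ denotes the integer part of $x$. Fix $\gamma\in(0,1)$. For integers $N\ge1$ and $l=1,\dots,2^{[N^\gamma]}$, $\Delta Z_{l,N}=Z_{l2^{-[N^\gamma]}+2^{-N}}-Z_{l2^{-[N^\gamma]}}$. *)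

theory Defs
  imports "HOL-Probability.Probability"
begin

locale two_sided_brownian_motion = prob_space M for M :: "'a measure" +
  fixes B :: "real \<Rightarrow> 'a \<Rightarrow> real"
  assumes random_variable_B: "\<And>y. random_variable borel (B y)"
    and B_zero: "AE \<omega> in M. B 0 \<omega> = 0"
    and normal_increments: "\<And>s t. s < t \<Longrightarrow>
      distributed M lborel (\<lambda>\<omega>. B t \<omega> - B s \<omega>) (normal_density 0 (sqrt (t - s)))"
    and indep_increments: "\<And>n (\<tau> :: nat \<Rightarrow> real). strict_mono_on {..n} \<tau> \<Longrightarrow>
      indep_vars (\<lambda>_. borel) (\<lambda>i \<omega>. B (\<tau> (Suc i)) \<omega> - B (\<tau> i) \<omega>) {..<n}"
    and continuous_paths: "AE \<omega> in M. continuous_on UNIV (\<lambda>y. B y \<omega>)"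

text \<open>
  Points of $R^q$ are functions on \<open>{..<q}\<close>, with Lebesgue measure
  \<open>lebesgue_pow q\<close>.  An elementary function is given by a grid
  \<open>\<tau> 0 < \<dots> < \<tau> n\<close> and coefficients \<open>a\<close>; only boxes with pairwise distinct
  sides are used, so that it vanishes on all diagonals.
\<close>

abbreviation lebesgue_pow :: "nat \<Rightarrow> (nat \<Rightarrow> real) measure" where
  "lebesgue_pow q \<equiv> \<Pi>\<^sub>M i\<in>{..<q}. lborel"

definition off_diagonal :: "nat \<Rightarrow> nat \<Rightarrow> (nat \<Rightarrow> nat) set" where
  "off_diagonal q n = {k \<in> {..<q} \<rightarrow>\<^sub>E {..<n}. inj_on k {..<q}}"

definition elementary_fun ::
    "nat \<Rightarrow> nat \<Rightarrow> (nat \<Rightarrow> real) \<Rightarrow> ((nat \<Rightarrow> nat) \<Rightarrow> real) \<Rightarrow> (nat \<Rightarrow> real) \<Rightarrow> real" where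
  "elementary_fun q n \<tau> a y =
    (\<Sum>k\<in>off_diagonal q n. a k * (\<Prod>i<q. indicator {\<tau> (k i)<..\<tau> (Suc (k i))} (y i)))"

definition elementary_integral ::
    "(real \<Rightarrow> 'a \<Rightarrow> real) \<Rightarrow> nat \<Rightarrow> nat \<Rightarrow> (nat \<Rightarrow> real) \<Rightarrow> ((nat \<Rightarrow> nat) \<Rightarrow> real) \<Rightarrow> 'a \<Rightarrow> real" where
  "elementary_integral B q n \<tau> a \<omega> =
    (\<Sum>k\<in>off_diagonal q n. a k * (\<Prod>i<q. B (\<tau> (Suc (k i))) \<omega> - B (\<tau> (k i)) \<omega>))"

definition square_integrable :: "'b measure \<Rightarrow> ('b \<Rightarrow> real) \<Rightarrow> bool" where
  "square_integrable M f \<longleftrightarrow> f \<in> borel_measurable M \<and> integrable M (\<lambda>x. (f x)\<^sup>2)"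

text \<open>
  The multiple Wiener--Ito integral $I_q(f)$ is the $L^2$-continuous extension of
  \<open>elementary_integral\<close> to $L^2(R^q)$.  It is a random variable determined only up to
  almost sure equality, so it is rendered as a relation: \<open>X\<close> is a version of $I_q(f)$.
\<close>

definition has_multiple_wiener_integral ::
    "'a measure \<Rightarrow> (real \<Rightarrow> 'a \<Rightarrow> real) \<Rightarrow> nat \<Rightarrow> ((nat \<Rightarrow> real) \<Rightarrow> real) \<Rightarrow> ('a \<Rightarrow> real) \<Rightarrow> bool" where
  "has_multiple_wiener_integral M B q f X \<longleftrightarrow>
    square_integrable (lebesgue_pow q) f \<and> square_integrable M X \<and>
    (\<exists>(n :: nat \<Rightarrow> nat) (\<tau> :: nat \<Rightarrow> nat \<Rightarrow> real) (a :: nat \<Rightarrow> (nat \<Rightarrow> nat) \<Rightarrow> real).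
      (\<forall>m. strict_mono_on {..n m} (\<tau> m)) \<and>
      (\<lambda>m. \<integral>y. (elementary_fun q (n m) (\<tau> m) (a m) y - f y)\<^sup>2 \<partial>lebesgue_pow q)
        \<longlonglongrightarrow> 0 \<and>
      (\<lambda>m. \<integral>\<omega>. (elementary_integral B q (n m) (\<tau> m) (a m) \<omega> - X \<omega>)\<^sup>2 \<partial>M)
        \<longlonglongrightarrow> 0)"

definition pos_powr :: "real \<Rightarrow> real \<Rightarrow> real" where
  "pos_powr x a = (if x > 0 then x powr a else 0)"

definition hermite_integrand :: "real \<Rightarrow> nat \<Rightarrow> real \<Rightarrow> real \<Rightarrow> (nat \<Rightarrow> real) \<Rightarrow> real" where
  "hermite_integrand d q H u y = d * (\<Prod>i<q. pos_powr (u - y i) (- (1/2 + (1 - H) / real q)))"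

text \<open>
  The time integral may diverge for \<open>y\<close> in a null set (on diagonals); it is then 0 by
  convention, which does not affect the class of the kernel in $L^2(R^q)$.
\<close>

definition hermite_kernel :: "real \<Rightarrow> nat \<Rightarrow> real \<Rightarrow> real \<Rightarrow> (nat \<Rightarrow> real) \<Rightarrow> real" where
  "hermite_kernel d q H t y = (LBINT u:{0..t}. hermite_integrand d q H u y)"

text \<open>
  \<open>d\<close> is the normalising constant $d(q,H)$; the last two conditions determine it.
\<close>

definition hermite_process ::
    "'a measure \<Rightarrow> (real \<Rightarrow> 'a \<Rightarrow> real) \<Rightarrow> nat \<Rightarrow> real \<Rightarrow> real \<Rightarrow> (real \<Rightarrow> 'a \<Rightarrow> real) \<Rightarrow> bool" where
  "hermite_process M B q H d Z \<longleftrightarrow>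
    (\<forall>t\<ge>0. has_multiple_wiener_integral M B q (hermite_kernel d q H t) (Z t)) \<and>
    d > 0 \<and> (\<forall>t\<ge>0. (\<integral>\<omega>. (Z t \<omega>)\<^sup>2 \<partial>M) = t powr (2 * H))"

definition block_exp :: "real \<Rightarrow> nat \<Rightarrow> nat" where
  "block_exp \<gamma> N = nat \<lfloor>real N powr \<gamma>\<rfloor>"

definition increment :: "real \<Rightarrow> (real \<Rightarrow> 'a \<Rightarrow> real) \<Rightarrow> nat \<Rightarrow> nat \<Rightarrow> 'a \<Rightarrow> real" where
  "increment \<gamma> Z l N \<omega> =
    Z (real l / 2 ^ block_exp \<gamma> N + 1 / 2 ^ N) \<omega> - Z (real l / 2 ^ block_exp \<gamma> N) \<omega>"

definition power_variation ::
    "real \<Rightarrow> real \<Rightarrow> nat \<Rightarrow> (real \<Rightarrow> 'a \<Rightarrow> real) \<Rightarrow> nat \<Rightarrow> 'a \<Rightarrow> real" where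
  "power_variation \<gamma> H p Z N \<omega> =
    2 powr (real p * H * real N) / 2 ^ block_exp \<gamma> N *
      (\<Sum>l = 1..2 ^ block_exp \<gamma> N. increment \<gamma> Z l N \<omega> ^ p)"

end

theory Submission
  imports Defs "HOL-Real_Asymp.Real_Asymp"
begin

text \<open>
  For $h > 0$ the kernels satisfy $h^{-H}(K_{t+h} - K_t)(y) = h^{-q/2} K_1((y-t)/h)$ almost everywhere.
  Approximate $K_1$ in $L^2(R^q)$ by one elementary function $e$.  By hypercontractivity the normalised
  increments $X_l = 2^{HN} \Delta Z_{l,N}$ are close in every $L^r$, uniformly in $l$ and $N$, to the
  integrals $Y_l$ of the rescaled translates of $e$.  All $Y_l$ have the law of $I_q(e)$, and since $e$
  has bounded support while $2^{-N}$ is eventually negligible against the spacing $2^{-[N^\gamma]}$,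
  the $Y_l$ are pairwise independent for large $N$.  The weak law of large numbers for $Y_l^p$ then
  gives the claim, without any decay estimate for the kernel.
\<close>

section \<open>Random variables with finite moments\<close>

text \<open>The obstacle is the passage from kernels to p-th powers. Closeness of kernels in L^2
  controls only the second moment of X_l - Y_l, whereas x^p - y^p also carries a factor of degree p
  - 1. So moments of high order must be bounded by the L^2 norm of the kernel alone, with a constant
  blind to the grid, to l and to N. Such a bound is proved for elementary integrals, which are
  multilinear polynomials in independent Gaussian increments, and it passes to general kernels by
  Fatou's lemma. The order of choices matters. The function e is fixed by the target accuracy before
  N tends to infinity, so its support has a fixed length: \<gamma> < 1 makes the scaled supports fit
  between consecutive starting points, and \<gamma> > 0 makes the number of terms grow. The limit is
  identified by the same stability estimate that links X_l to Y_l, applied to \<open>Z 1\<close> and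
  I_q(e) themselves.\<close>

definition all_moments :: "'a measure \<Rightarrow> ('a \<Rightarrow> real) \<Rightarrow> bool" where
  "all_moments M X \<longleftrightarrow> X \<in> borel_measurable M \<and> (\<forall>k. integrable M (\<lambda>\<omega>. X \<omega> ^ k))"

lemma all_moments_measurable: "all_moments M X \<Longrightarrow> X \<in> borel_measurable M"
  by (simp add: all_moments_def)

lemma all_moments_integrable_power: "all_moments M X \<Longrightarrow> integrable M (\<lambda>\<omega>. X \<omega> ^ k)"
  by (simp add: all_moments_def)

lemma all_moments_integrable: "all_moments M X \<Longrightarrow> integrable M X"
  using all_moments_integrable_power[of M X 1] by simp

lemma all_moments_power: "all_moments M X \<Longrightarrow> all_moments M (\<lambda>\<omega>. X \<omega> ^ m)"
  by (auto simp: all_moments_def power_mult[symmetric])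

text \<open>From 2|xy|^k <= x^(2k) + y^(2k). Together with closure under sums this makes
  \<open>all_moments\<close> an algebra of random variables, so later integrability goals reduce to
  Gaussian increments or to Wiener integrals.\<close>

lemma all_moments_mult:
  assumes "all_moments M X" "all_moments M Y"
  shows "all_moments M (\<lambda>\<omega>. X \<omega> * Y \<omega>)"
proof -
  note [measurable] = assms[THEN all_moments_measurable]
  have "integrable M (\<lambda>\<omega>. (X \<omega> * Y \<omega>) ^ k)" for k
  proof (rule Bochner_Integration.integrable_bound)
    show "integrable M (\<lambda>\<omega>. X \<omega> ^ (2*k) + Y \<omega> ^ (2*k))"
      using assms[THEN all_moments_integrable_power] by simp
    have "\<bar>x * y\<bar> ^ k \<le> \<bar>x ^ (2*k) + y ^ (2*k)\<bar>" for x y :: real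
    proof -
      have "2 * (\<bar>x\<bar> ^ k * \<bar>y\<bar> ^ k) \<le> x ^ (2*k) + y ^ (2*k)"
        using sum_squares_bound[of "\<bar>x\<bar>^k" "\<bar>y\<bar>^k"]
        by (simp add: power_even_abs power_mult[symmetric] mult.commute mult.left_commute)
      moreover have "0 \<le> \<bar>x\<bar> ^ k * \<bar>y\<bar> ^ k" by simp
      ultimately show ?thesis unfolding abs_mult power_mult_distrib by linarith
    qed
    then show "AE \<omega> in M. norm ((X \<omega> * Y \<omega>) ^ k) \<le> norm (X \<omega> ^ (2*k) + Y \<omega> ^ (2*k))"
      by (simp add: power_abs)
  qed measurable
  then show ?thesis by (auto simp: all_moments_def)
qed

context prob_space
begin

text \<open>Fatou's lemma will deliver even powers only; |x|^k <= 1 + x^(2k) recovers the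
  others.\<close>

lemma all_momentsI_even:
  assumes [measurable]: "X \<in> borel_measurable M"
    and "\<And>r. r \<ge> 1 \<Longrightarrow> integrable M (\<lambda>\<omega>. X \<omega> ^ (2*r))"
  shows "all_moments M X"
proof -
  have "integrable M (\<lambda>\<omega>. X \<omega> ^ k)" for k
  proof (cases "k = 0")
    case False
    show ?thesis
    proof (rule Bochner_Integration.integrable_bound)
      show "integrable M (\<lambda>\<omega>. 1 + X \<omega> ^ (2*k))"
        using False assms(2)[of k] by simp
      have "\<bar>x\<bar> ^ k \<le> \<bar>1 + x ^ (2*k)\<bar>" for x :: real
        using sum_squares_bound[of "\<bar>x\<bar>^k" 1] zero_le_power[of "\<bar>x\<bar>" k]
        by (simp add: power_even_abs power_mult[symmetric] mult.commute)
      then show "AE \<omega> in M. norm (X \<omega> ^ k) \<le> norm (1 + X \<omega> ^ (2*k))"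
        by (simp add: power_abs)
    qed measurable
  qed simp
  then show ?thesis by (simp add: all_moments_def)
qed

lemma all_moments_const: "all_moments M (\<lambda>_. c)"
  by (simp add: all_moments_def)

lemma all_moments_add:
  assumes "all_moments M X" "all_moments M Y"
  shows "all_moments M (\<lambda>\<omega>. X \<omega> + Y \<omega>)"
proof -
  have "integrable M (\<lambda>\<omega>. (X \<omega> + Y \<omega>) ^ k)" for k
    unfolding binomial_ring
    by (intro Bochner_Integration.integrable_sum all_moments_integrable
        all_moments_mult all_moments_power assms all_moments_const)
  then show ?thesis using assms by (auto simp: all_moments_def)
qed

lemma all_moments_sum:
  assumes "\<And>i. i \<in> I \<Longrightarrow> all_moments M (X i)"
  shows "all_moments M (\<lambda>\<omega>. \<Sum>i\<in>I. X i \<omega>)"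
  using assms
  by (induction I rule: infinite_finite_induct) (auto intro: all_moments_const all_moments_add)

lemma all_moments_prod:
  assumes "\<And>i. i \<in> I \<Longrightarrow> all_moments M (X i)"
  shows "all_moments M (\<lambda>\<omega>. \<Prod>i\<in>I. X i \<omega>)"
  using assms
  by (induction I rule: infinite_finite_induct) (auto intro: all_moments_const all_moments_mult)

lemma all_moments_diff:
  assumes "all_moments M X" "all_moments M Y"
  shows "all_moments M (\<lambda>\<omega>. X \<omega> - Y \<omega>)"
  using all_moments_add[OF assms(1) all_moments_mult[OF all_moments_const[of "-1"] assms(2)]] by simp

end

section \<open>Hypercontractivity of Gaussian polynomials\<close>

text \<open>Polynomials in which no variable is repeated, with one coefficient per set of variables.
  For independent centred \<open>\<xi> j\<close> of variance \<open>v j\<close>, evaluation at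
  \<open>v\<close> with squared coefficients is the second moment of the polynomial in \<xi>; in
  this form the variance enters \<open>hypercontractivity\<close>.\<close>

definition multilinear :: "(nat \<Rightarrow> real) \<Rightarrow> nat \<Rightarrow> (nat set \<Rightarrow> real) \<Rightarrow> real" where
  "multilinear x n c = (\<Sum>S\<in>Pow {..<n}. c S * (\<Prod>j\<in>S. x j))"

text \<open>Subsets of \<open>{..<Suc n}\<close> either avoid \<open>n\<close> or contain it; the
  induction over the number of variables runs on this split.\<close>

lemma multilinear_Suc:
  "multilinear x (Suc n) c = multilinear x n c + x n * multilinear x n (\<lambda>S. c (insert n S))"
proof -
  have inj: "inj_on (insert n) (Pow {..<n})"
    by (rule inj_onI) (metis Pow_iff insert_ident lessThan_iff less_irrefl subset_eq)
  have "multilinear x (Suc n) c = multilinear x n c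
      + (\<Sum>S\<in>insert n ` Pow {..<n}. c S * (\<Prod>j\<in>S. x j))"
    unfolding multilinear_def lessThan_Suc Pow_insert
    by (rule sum.union_disjoint) auto
  also have "(\<Sum>S\<in>insert n ` Pow {..<n}. c S * (\<Prod>j\<in>S. x j))
      = (\<Sum>S\<in>Pow {..<n}. c (insert n S) * (\<Prod>j\<in>insert n S. x j))"
    by (subst sum.reindex[OF inj]) simp
  also have "\<dots> = (\<Sum>S\<in>Pow {..<n}. x n * (c (insert n S) * (\<Prod>j\<in>S. x j)))"
  proof (rule sum.cong[OF refl])
    fix S assume "S \<in> Pow {..<n}"
    then have "finite S" "n \<notin> S" by (auto intro: finite_subset)
    then show "c (insert n S) * (\<Prod>j\<in>insert n S. x j) = x n * (c (insert n S) * (\<Prod>j\<in>S. x j))"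
      by simp
  qed
  finally show ?thesis by (simp add: multilinear_def sum_distrib_left)
qed

lemma multilinear_nonneg:
  assumes "\<And>j. j < n \<Longrightarrow> x j \<ge> 0" "\<And>S. c S \<ge> 0"
  shows "multilinear x n c \<ge> 0"
  unfolding multilinear_def
  by (intro sum_nonneg mult_nonneg_nonneg prod_nonneg assms) (use assms in auto)

lemma sum_even_only:
  fixes f :: "nat \<Rightarrow> real"
  assumes "\<And>i. odd i \<Longrightarrow> f i = 0"
  shows "(\<Sum>i\<le>2*r. f i) = (\<Sum>j\<le>r. f (2*j))"
  by (induction r) (use assms in \<open>simp_all add: algebra_simps\<close>)

context prob_space
begin

text \<open>A crude form of Hoelder's inequality: after scaling \<open>U\<close> by \<open>A\<close>
  and \<open>W\<close> by \<open>D\<close>, the bound u^(r-j) w^j <= max(u,w)^r <= u^r + w^r costs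
  only the factor 2.\<close>

lemma mixed_moment_le:
  assumes U: "all_moments M U" "\<And>\<omega>. U \<omega> \<ge> 0" and W: "all_moments M W" "\<And>\<omega>. W \<omega> \<ge> 0"
    and A: "expectation (\<lambda>\<omega>. U \<omega> ^ r) \<le> A ^ r" "A \<ge> 0"
    and D: "expectation (\<lambda>\<omega>. W \<omega> ^ r) \<le> D ^ r" "D \<ge> 0"
    and j: "1 \<le> j" "j \<le> r"
  shows "expectation (\<lambda>\<omega>. U \<omega> ^ (r-j) * W \<omega> ^ j) \<le> 2 * A ^ (r-j) * D ^ j"
proof -
  have int: "integrable M (\<lambda>\<omega>. U \<omega> ^ a * W \<omega> ^ b)" for a b
    by (intro all_moments_integrable all_moments_mult all_moments_power U W)
  have zero: "AE \<omega> in M. X \<omega> = 0"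
    if "all_moments M X" "\<And>\<omega>. X \<omega> \<ge> 0" "expectation (\<lambda>\<omega>. X \<omega> ^ r) \<le> 0" for X
  proof -
    have "expectation (\<lambda>\<omega>. X \<omega> ^ r) = 0"
      using that by (intro antisym integral_nonneg_AE) auto
    then have "AE \<omega> in M. X \<omega> ^ r = 0"
      by (subst (asm) integral_nonneg_eq_0_iff_AE)
        (use that in \<open>auto intro: all_moments_integrable_power\<close>)
    then show ?thesis by eventually_elim simp
  qed
  \<comment> \<open>Scaling divides by \<open>A\<close> and \<open>D\<close>, so vanishing bounds
    are treated apart; there the variable concerned is almost surely 0. For \<open>j = r\<close> the
    factor with \<open>U\<close> is absent, hence a case of its own.\<close>
  consider "A = 0" "j < r" | "A = 0" "j = r" | "D = 0" | "A > 0" "D > 0"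
    using A D j by linarith
  then show ?thesis
  proof cases
    case 1
    have "AE \<omega> in M. U \<omega> ^ (r-j) * W \<omega> ^ j = 0"
      using zero[OF U] A 1 by (auto simp: power_0_left)
    then have "expectation (\<lambda>\<omega>. U \<omega> ^ (r-j) * W \<omega> ^ j) = 0"
      by (rule integral_eq_zero_AE)
    then show ?thesis using A D by simp
  next
    case 2
    moreover have "0 \<le> D ^ r" using D by simp
    ultimately have "expectation (\<lambda>\<omega>. W \<omega> ^ r) \<le> 2 * D ^ r" using D by linarith
    with 2 show ?thesis by simp
  next
    case 3
    have "AE \<omega> in M. U \<omega> ^ (r-j) * W \<omega> ^ j = 0"
      using zero[OF W] D 3 j by (auto simp: power_0_left)
    then have "expectation (\<lambda>\<omega>. U \<omega> ^ (r-j) * W \<omega> ^ j) = 0"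
      by (rule integral_eq_zero_AE)
    then show ?thesis using A D by simp
  next
    case 4
    have bound: "u ^ (r-j) * w ^ j \<le> u ^ r + w ^ r" if "u \<ge> 0" "w \<ge> 0" for u w :: real
    proof -
      have "u ^ (r-j) * w ^ j \<le> max u w ^ (r-j) * max u w ^ j"
        using that by (intro mult_mono power_mono) auto
      also have "\<dots> = max u w ^ r" using j by (simp add: power_add[symmetric])
      also have "\<dots> \<le> u ^ r + w ^ r" using that by (auto simp: max_def)
      finally show ?thesis .
    qed
    have pw: "U \<omega> ^ (r-j) * W \<omega> ^ j
        \<le> A ^ (r-j) * D ^ j * (U \<omega> ^ r / A ^ r + W \<omega> ^ r / D ^ r)" for \<omega>
      using bound[of "U \<omega> / A" "W \<omega> / D"] U(2)[of \<omega>] W(2)[of \<omega>] 4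
      by (simp add: power_divide field_simps)
    have "expectation (\<lambda>\<omega>. U \<omega> ^ (r-j) * W \<omega> ^ j)
        \<le> expectation (\<lambda>\<omega>. A ^ (r-j) * D ^ j * (U \<omega> ^ r / A ^ r + W \<omega> ^ r / D ^ r))"
      by (intro integral_mono int pw Bochner_Integration.integrable_mult_right
          Bochner_Integration.integrable_add integrable_divide all_moments_integrable_power U W)
    also have "\<dots> = A ^ (r-j) * D ^ j *
        (expectation (\<lambda>\<omega>. U \<omega> ^ r) / A ^ r + expectation (\<lambda>\<omega>. W \<omega> ^ r) / D ^ r)"
      by (subst Bochner_Integration.integral_mult_right_zero, subst Bochner_Integration.integral_add)
        (auto intro!: all_moments_integrable_power U W)
    also have "\<dots> \<le> A ^ (r-j) * D ^ j * (1 + 1)"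
      using A D 4 by (intro mult_left_mono add_mono) (auto simp: divide_le_eq)
    finally show ?thesis by simp
  qed
qed

text \<open>The factor in the even moments is the double factorial (2j-1)!!. It stays a quotient
  because it is absorbed into the constant \<open>L\<close> without being estimated.\<close>

lemma normal_all_moments:
  assumes X: "distributed M lborel X (normal_density 0 \<sigma>)" and \<sigma>: "\<sigma> > 0"
  shows "all_moments M X"
    and "odd k \<Longrightarrow> expectation (\<lambda>\<omega>. X \<omega> ^ k) = 0"
    and "expectation (\<lambda>\<omega>. X \<omega> ^ (2*j)) = fact (2*j) / (2 ^ j * fact j) * (\<sigma>\<^sup>2) ^ j"
proof -
  have mX: "X \<in> borel_measurable M" using distributed_measurable[OF X] by simp
  have "integrable M (\<lambda>\<omega>. X \<omega> ^ k)" for k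
    using integrable_normal_moment[OF \<sigma>, of 0 k]
    by (subst distributed_integrable[OF X, symmetric]) (auto simp: normal_density_nonneg)
  then show "all_moments M X" using mX by (simp add: all_moments_def)
  show "expectation (\<lambda>\<omega>. X \<omega> ^ k) = 0" if "odd k"
  proof -
    from that obtain m where m: "k = 2*m+1" by (rule oddE)
    show ?thesis
      using integral_normal_moment_odd[OF \<sigma>, of 0 m] distributed_integral[OF X, of "\<lambda>x. x ^ k"]
      by (simp add: m normal_density_nonneg)
  qed
  show "expectation (\<lambda>\<omega>. X \<omega> ^ (2*j)) = fact (2*j) / (2 ^ j * fact j) * (\<sigma>\<^sup>2) ^ j"
    using integral_normal_moment_even[OF \<sigma>, of 0 j] \<sigma>
      distributed_integral[OF X, of "\<lambda>x. x ^ (2*j)"]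
    by (simp add: normal_density_nonneg power_divide)
qed

lemma all_moments_multilinear:
  assumes "\<And>j. j < n \<Longrightarrow> all_moments M (\<xi> j)"
  shows "all_moments M (\<lambda>\<omega>. multilinear (\<lambda>j. \<xi> j \<omega>) n c)"
  unfolding multilinear_def
  by (intro all_moments_sum all_moments_mult all_moments_const all_moments_prod assms) auto

lemma multilinear_measurable:
  "(\<lambda>x. multilinear x n c) \<in> borel_measurable (PiM {..<n} (\<lambda>_. borel))"
  unfolding multilinear_def
  by (intro borel_measurable_sum borel_measurable_times borel_measurable_const borel_measurable_prod)
    auto

lemma multilinear_indep:
  assumes ind: "indep_vars (\<lambda>_. borel) \<xi> {..<m}" and n: "n < m"
    and am: "\<And>j. j < m \<Longrightarrow> all_moments M (\<xi> j)"
  shows "expectation (\<lambda>\<omega>. \<xi> n \<omega> ^ i *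
        (multilinear (\<lambda>j. \<xi> j \<omega>) n c ^ a * multilinear (\<lambda>j. \<xi> j \<omega>) n c' ^ b))
    = expectation (\<lambda>\<omega>. \<xi> n \<omega> ^ i) *
      expectation (\<lambda>\<omega>. multilinear (\<lambda>j. \<xi> j \<omega>) n c ^ a * multilinear (\<lambda>j. \<xi> j \<omega>) n c' ^ b)"
proof (rule indep_var_lebesgue_integral)
  define f where "f = (\<lambda>x :: nat \<Rightarrow> real. x n ^ i)"
  define g where "g = (\<lambda>x. multilinear x n c ^ a * multilinear x n c' ^ b)"
  have "indep_var borel (f \<circ> (\<lambda>\<omega>. restrict (\<lambda>i. \<xi> i \<omega>) {n}))
      borel (g \<circ> (\<lambda>\<omega>. restrict (\<lambda>i. \<xi> i \<omega>) {..<n}))"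
  proof (rule indep_var_compose[OF indep_var_restrict[OF ind]])
    show "f \<in> borel_measurable (PiM {n} (\<lambda>_. borel))"
      unfolding f_def by (intro borel_measurable_power) auto
    show "g \<in> borel_measurable (PiM {..<n} (\<lambda>_. borel))"
      unfolding g_def by (intro borel_measurable_times borel_measurable_power multilinear_measurable)
  qed (use n in auto)
  moreover have "multilinear (restrict (\<lambda>i. \<xi> i \<omega>) {..<n}) n c = multilinear (\<lambda>i. \<xi> i \<omega>) n c" for c \<omega>
    unfolding multilinear_def
    by (intro sum.cong arg_cong2[where f="(*)"] prod.cong) auto
  ultimately show "indep_var borel (\<lambda>\<omega>. \<xi> n \<omega> ^ i)
      borel (\<lambda>\<omega>. multilinear (\<lambda>j. \<xi> j \<omega>) n c ^ a * multilinear (\<lambda>j. \<xi> j \<omega>) n c' ^ b)"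
    by (simp add: comp_def f_def g_def)
qed (use n in \<open>auto intro!: all_moments_integrable all_moments_power all_moments_mult
      all_moments_multilinear am\<close>)

end

text \<open>Only finitely many \<open>j\<close> occur, so some bound exists. What matters is that it
  depends on \<open>r\<close> alone, not on the number of variables or the coefficients.\<close>

lemma moment_constant_exists:
  "\<exists>L\<ge>1. \<forall>j\<in>{1..r}. 2 * (real ((2*r) choose (2*j)) * (fact (2*j) / (2 ^ j * fact j))) \<le> L"
proof -
  define h where "h j = 2 * (real ((2*r) choose (2*j)) * (fact (2*j) / (2 ^ j * fact j)))" for j
  have "\<forall>j\<in>{1..r}. h j \<le> 1 + (\<Sum>j\<in>{1..r}. h j)"
    using member_le_sum[of _ "{1..r}" h] by (force simp: h_def)
  moreover have "(\<Sum>j\<in>{1..r}. h j) \<ge> 0" by (intro sum_nonneg) (simp add: h_def)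
  ultimately show ?thesis unfolding h_def by (intro exI[of _ "1 + (\<Sum>j\<in>{1..r}. h j)"]) (simp add: h_def)
qed

text \<open>
  Induction on the number of variables: a polynomial is \<open>P + \<xi> n * Q\<close> with \<open>P\<close>, \<open>Q\<close> independent of
  \<open>\<xi> n\<close> and \<open>Q\<close> of smaller degree, so each factor \<open>\<xi> n\<close> releases one factor \<open>L\<close>, which absorbs the
  binomial coefficient, the Gaussian moment and the \<open>2\<close> of \<open>mixed_moment_le\<close>.
\<close>

lemma (in prob_space) hypercontractivity:
  fixes v :: "nat \<Rightarrow> real"
  assumes L: "L \<ge> 1"
      "\<forall>j\<in>{1..r}. 2 * (real ((2*r) choose (2*j)) * (fact (2*j) / (2 ^ j * fact j))) \<le> L"
    and ind: "indep_vars (\<lambda>_. borel) \<xi> {..<m}"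
    and v: "\<And>j. j < m \<Longrightarrow> v j > 0"
    and normal: "\<And>j. j < m \<Longrightarrow> distributed M lborel (\<xi> j) (normal_density 0 (sqrt (v j)))"
  shows "n \<le> m \<Longrightarrow> (\<And>S. finite S \<Longrightarrow> card S > q \<Longrightarrow> c S = 0) \<Longrightarrow>
    expectation (\<lambda>\<omega>. multilinear (\<lambda>j. \<xi> j \<omega>) n c ^ (2*r))
      \<le> (L ^ q * multilinear v n (\<lambda>S. (c S)\<^sup>2)) ^ r"
proof (induction n arbitrary: q c)
  case 0
  have "1 * (c {})\<^sup>2 \<le> L ^ q * (c {})\<^sup>2"
    using L by (intro mult_right_mono one_le_power) auto
  then have "((c {})\<^sup>2) ^ r \<le> (L ^ q * (c {})\<^sup>2) ^ r"
    by (intro power_mono) auto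
  then show ?case by (simp add: multilinear_def power_mult prob_space)
next
  case (Suc n)
  define P where "P \<omega> = multilinear (\<lambda>j. \<xi> j \<omega>) n c" for \<omega>
  \<comment> \<open>Sets that contain \<open>n\<close> must be zeroed: for them
    \<open>insert n S = S\<close>, and the degree would not drop.\<close>
  define c' where "c' S = (if n \<in> S then 0 else c (insert n S))" for S
  define Q where "Q \<omega> = multilinear (\<lambda>j. \<xi> j \<omega>) n c'" for \<omega>
  have c'_eq: "multilinear x n (\<lambda>S. F (c (insert n S))) = multilinear x n (\<lambda>S. F (c' S))" for x F
    unfolding multilinear_def by (rule sum.cong) (auto simp: c'_def)
  have n: "n < m" "n \<le> m" using Suc by auto
  have am: "all_moments M (\<xi> j)" if "j < m" for j
    using normal_all_moments(1)[OF normal[OF that]] v[OF that] by simp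
  note am_n = am[OF n(1)]
  have amP: "all_moments M P" and amQ: "all_moments M Q"
    unfolding P_def[abs_def] Q_def[abs_def] using am n by (auto intro!: all_moments_multilinear)
  have split: "multilinear (\<lambda>j. \<xi> j \<omega>) (Suc n) c = \<xi> n \<omega> * Q \<omega> + P \<omega>" for \<omega>
    using c'_eq[of _ "\<lambda>x. x"] by (simp add: multilinear_Suc P_def Q_def)
  define VP where "VP = multilinear v n (\<lambda>S. (c S)\<^sup>2)"
  define VQ where "VQ = multilinear v n (\<lambda>S. (c' S)\<^sup>2)"
  have V_nonneg: "VP \<ge> 0" "VQ \<ge> 0"
    unfolding VP_def VQ_def using v n by (auto intro!: multilinear_nonneg dest: less_trans intro: less_imp_le)
  have V_split: "multilinear v (Suc n) (\<lambda>S. (c S)\<^sup>2) = VP + v n * VQ"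
    using c'_eq[of _ "\<lambda>x. x\<^sup>2"] by (simp add: multilinear_Suc VP_def VQ_def)
  \<comment> \<open>\<open>A\<close> and \<open>D\<close> are the induction bounds for
    \<open>P\<close> and for \<open>Q\<close>, which has degree at most \<open>q - 1\<close>;
    \<open>T\<close> is the share of the target that belongs to \<open>\<xi> n * Q\<close>.\<close>
  define A where "A = L ^ q * VP"
  define D where "D = L ^ (q - 1) * VQ"
  define T where "T = L ^ q * (v n * VQ)"
  have nonneg: "A \<ge> 0" "D \<ge> 0" "T \<ge> 0"
    using L V_nonneg v[OF n(1)] by (auto simp: A_def D_def T_def)
  have EP: "expectation (\<lambda>\<omega>. P \<omega> ^ (2*r)) \<le> A ^ r"
    unfolding P_def A_def VP_def using n Suc by auto
  have EQ: "expectation (\<lambda>\<omega>. Q \<omega> ^ (2*r)) \<le> D ^ r"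
    unfolding Q_def D_def VQ_def
  proof (rule Suc.IH[OF n(2)])
    fix S :: "nat set" assume S: "finite S" "card S > q - 1"
    show "c' S = 0"
      using Suc.prems(2)[of "insert n S"] S by (auto simp: c'_def)
  qed
  \<comment> \<open>For \<open>q = 0\<close> truncated subtraction gives \<open>q - 1 = 0\<close>
    and no factor \<open>L\<close> is gained, but then every coefficient of \<open>Q\<close>
    vanishes.\<close>
  have DT: "L * v n * D \<le> T \<or> VQ = 0"
  proof (cases "q = 0")
    case True
    have "VQ = 0" unfolding VQ_def multilinear_def
    proof (rule sum.neutral, rule ballI)
      fix S assume "S \<in> Pow {..<n}"
      then have "finite S" by (auto intro: finite_subset)
      then show "(c' S)\<^sup>2 * prod v S = 0"
        using Suc.prems(2)[of "insert n S"] True by (simp add: c'_def card_gt_0_iff)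
    qed
    then show ?thesis by simp
  next
    case False
    then have "L * L ^ (q - 1) = L ^ q" by (simp add: power_eq_if)
    then have "L * v n * D = T" unfolding D_def T_def by (metis mult.assoc mult.commute)
    then show ?thesis by simp
  qed
  define f where "f i = real ((2*r) choose i) * (expectation (\<lambda>\<omega>. \<xi> n \<omega> ^ i) *
      expectation (\<lambda>\<omega>. P \<omega> ^ (2*r - i) * Q \<omega> ^ i))" for i
  have "expectation (\<lambda>\<omega>. multilinear (\<lambda>j. \<xi> j \<omega>) (Suc n) c ^ (2*r))
      = expectation (\<lambda>\<omega>. \<Sum>i\<le>2*r. real ((2*r) choose i) *
          (\<xi> n \<omega> ^ i * (P \<omega> ^ (2*r - i) * Q \<omega> ^ i)))"
    unfolding split binomial_ring
    by (intro Bochner_Integration.integral_cong sum.cong) (auto simp: power_mult_distrib ac_simps)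
  also have "\<dots> = (\<Sum>i\<le>2*r. real ((2*r) choose i) *
      expectation (\<lambda>\<omega>. \<xi> n \<omega> ^ i * (P \<omega> ^ (2*r - i) * Q \<omega> ^ i)))"
    by (subst Bochner_Integration.integral_sum)
      (auto intro!: all_moments_integrable all_moments_mult all_moments_power all_moments_const
        am_n amP amQ)
  also have "\<dots> = (\<Sum>i\<le>2*r. f i)"
    unfolding f_def P_def Q_def by (simp add: multilinear_indep[OF ind n(1) am])
  also have "\<dots> = (\<Sum>j\<le>r. f (2*j))"
    by (rule sum_even_only)
      (use normal_all_moments(2)[OF normal[OF n(1)]] v[OF n(1)] in \<open>simp add: f_def\<close>)
  \<comment> \<open>The surviving even terms are compared one by one with the binomial expansion of
    \<open>(T + A) ^ r\<close>.\<close>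
  also have "\<dots> \<le> (\<Sum>j\<le>r. real (r choose j) * T ^ j * A ^ (r - j))"
  proof (rule sum_mono)
    fix j assume "j \<in> {..r}"
    then have j: "j \<le> r" by simp
    have even_pow: "2*r - 2*j = 2 * (r - j)" by simp
    have E\<xi>: "expectation (\<lambda>\<omega>. \<xi> n \<omega> ^ (2*j)) = fact (2*j) / (2 ^ j * fact j) * v n ^ j"
      using normal_all_moments(3)[OF normal[OF n(1)], of j] v[OF n(1)] by simp
    show "f (2*j) \<le> real (r choose j) * T ^ j * A ^ (r - j)"
    proof (cases "j = 0")
      case True
      then show ?thesis using EP by (simp add: f_def prob_space)
    next
      case False
      then have j1: "1 \<le> j" by simp
      have "expectation (\<lambda>\<omega>. P \<omega> ^ (2*r - 2*j) * Q \<omega> ^ (2*j))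
          = expectation (\<lambda>\<omega>. ((P \<omega>)\<^sup>2) ^ (r - j) * ((Q \<omega>)\<^sup>2) ^ j)"
        by (simp add: power_mult[symmetric] even_pow)
      also have "\<dots> \<le> 2 * A ^ (r - j) * D ^ j"
        using EP EQ nonneg j j1
        by (intro mixed_moment_le) (auto intro: all_moments_power amP amQ simp: power_mult[symmetric])
      finally have mm: "expectation (\<lambda>\<omega>. P \<omega> ^ (2*r - 2*j) * Q \<omega> ^ (2*j)) \<le> 2 * A ^ (r - j) * D ^ j" .
      have "f (2*j) \<le> real ((2*r) choose (2*j)) * (fact (2*j) / (2 ^ j * fact j) * v n ^ j *
          (2 * A ^ (r - j) * D ^ j))"
        unfolding f_def E\<xi> using mm v[OF n(1)] by (intro mult_left_mono) auto
      also have "\<dots> = (2 * (real ((2*r) choose (2*j)) * (fact (2*j) / (2 ^ j * fact j)))) *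
          ((v n * D) ^ j * A ^ (r - j))"
        by (simp add: power_mult_distrib)
      also have "\<dots> \<le> L * ((v n * D) ^ j * A ^ (r - j))"
        using L j j1 nonneg v[OF n(1)] by (intro mult_right_mono) auto
      \<comment> \<open>With \<open>L ^ j\<close> one factor \<open>L\<close> accompanies each
        \<open>v n * D\<close>, and \<open>DT\<close> turns each such product into
        \<open>T\<close>.\<close>
      also have "\<dots> \<le> L ^ j * ((v n * D) ^ j * A ^ (r - j))"
        using L j1 nonneg v[OF n(1)] by (intro mult_right_mono) (auto intro: self_le_power)
      also have "\<dots> = (L * v n * D) ^ j * A ^ (r - j)"
        by (simp add: power_mult_distrib)
      also have "\<dots> \<le> T ^ j * A ^ (r - j)"
        using DT nonneg L v[OF n(1)]
        by (intro mult_right_mono) (auto intro!: power_mono simp: D_def)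
      also have "\<dots> \<le> real (r choose j) * (T ^ j * A ^ (r - j))"
        using nonneg zero_less_binomial[OF j]
          mult_right_mono[of 1 "real (r choose j)" "T ^ j * A ^ (r - j)"]
        by (simp add: Suc_le_eq)
      finally show ?thesis by (simp add: mult.assoc)
    qed
  qed
  also have "\<dots> = (T + A) ^ r" by (simp add: binomial_ring)
  also have "T + A = L ^ q * multilinear v (Suc n) (\<lambda>S. (c S)\<^sup>2)"
    unfolding V_split by (simp add: T_def A_def algebra_simps)
  finally show ?case .
qed

section \<open>Elementary functions and their integrals\<close>

text \<open>
  Increments of \<open>t \<mapsto> B t \<omega>\<close> give the elementary integral, those of \<open>t \<mapsto> of_bool (y i \<le> t)\<close>
  the elementary function at \<open>y\<close>; so identities in \<open>W\<close> transfer to both simultaneously.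
\<close>

definition grid_sum ::
    "(nat \<Rightarrow> real \<Rightarrow> real) \<Rightarrow> nat \<Rightarrow> nat \<Rightarrow> (nat \<Rightarrow> real) \<Rightarrow> ((nat \<Rightarrow> nat) \<Rightarrow> real) \<Rightarrow> real" where
  "grid_sum W q n \<tau> a = (\<Sum>k\<in>off_diagonal q n. a k * (\<Prod>i<q. W i (\<tau> (Suc (k i))) - W i (\<tau> (k i))))"

lemma finite_off_diagonal: "finite (off_diagonal q n)"
  unfolding off_diagonal_def by (rule finite_subset[of _ "{..<q} \<rightarrow>\<^sub>E {..<n}"]) (auto intro: finite_PiE)

lemma off_diagonalD:
  assumes "k \<in> off_diagonal q n"
  shows "i < q \<Longrightarrow> k i < n" "inj_on k {..<q}" "k \<in> extensional {..<q}"
  using assms by (auto simp: off_diagonal_def PiE_iff)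

lemma elementary_integral_grid_sum:
  "elementary_integral B q n \<tau> a \<omega> = grid_sum (\<lambda>_ t. B t \<omega>) q n \<tau> a"
  by (simp add: elementary_integral_def grid_sum_def)

lemma grid_less:
  assumes "strict_mono_on {..n} \<tau>" "j < n"
  shows "\<tau> j < \<tau> (Suc j)"
  using assms by (auto simp: strict_mono_on_def)

lemma elementary_fun_grid_sum:
  assumes "strict_mono_on {..n} \<tau>"
  shows "elementary_fun q n \<tau> a y = grid_sum (\<lambda>i t. of_bool (y i \<le> t)) q n \<tau> a"
  unfolding elementary_fun_def grid_sum_def
proof (intro sum.cong[OF refl] arg_cong2[where f="(*)"] prod.cong refl)
  fix k i assume "k \<in> off_diagonal q n" "i \<in> {..<q}"
  then have "\<tau> (k i) < \<tau> (Suc (k i))"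
    using grid_less[OF assms] off_diagonalD(1) by auto
  then show "indicator {\<tau> (k i)<..\<tau> (Suc (k i))} (y i)
      = (of_bool (y i \<le> \<tau> (Suc (k i))) - of_bool (y i \<le> \<tau> (k i)) :: real)"
    by (auto simp: indicator_def)
qed

lemma grid_sum_linear:
  "grid_sum W q n \<tau> (\<lambda>k. \<alpha> * a k + \<beta> * b k) = \<alpha> * grid_sum W q n \<tau> a + \<beta> * grid_sum W q n \<tau> b"
  by (simp add: grid_sum_def sum_distrib_left sum.distrib algebra_simps)

text \<open>Each coarse increment telescopes into fine ones, and multiplying out gives a sum over
  the fine multi-indices inside the coarse box. These stay injective because distinct coarse cells
  are disjoint. The new coefficients do not depend on \<open>W\<close>, which lets function and
  integral be refined together.\<close>

lemma grid_sum_refine: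
  assumes \<tau>: "strict_mono_on {..n} \<tau>" and \<tau>': "strict_mono_on {..n'} \<tau>'"
    and sub: "\<tau> ` {..n} \<subseteq> \<tau>' ` {..n'}"
  shows "\<exists>a'. \<forall>W. grid_sum W q n \<tau> a = grid_sum W q n' \<tau>' a'"
proof -
  have "\<forall>j\<in>{..n}. \<exists>l. l \<le> n' \<and> \<tau>' l = \<tau> j"
  proof
    fix j assume "j \<in> {..n}"
    then have "\<tau> j \<in> \<tau>' ` {..n'}" using sub by blast
    then show "\<exists>l. l \<le> n' \<and> \<tau>' l = \<tau> j" by force
  qed
  then obtain \<phi> where \<phi>: "\<And>j. j \<le> n \<Longrightarrow> \<phi> j \<le> n'" "\<And>j. j \<le> n \<Longrightarrow> \<tau>' (\<phi> j) = \<tau> j"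
    by (metis atMost_iff)
  have mono: "\<phi> i < \<phi> j" if "i < j" "j \<le> n" for i j
  proof -
    have "\<tau>' (\<phi> i) < \<tau>' (\<phi> j)" using \<phi>[of i] \<phi>[of j] that \<tau> by (auto simp: strict_mono_on_def)
    then show ?thesis
      using strict_mono_on_less[OF \<tau>', of "\<phi> i" "\<phi> j"] \<phi>(1)[of i] \<phi>(1)[of j] that by auto
  qed
  have mono': "\<phi> i \<le> \<phi> j" if "i \<le> j" "j \<le> n" for i j
    using mono[of i j] that by (cases "i = j") auto
  define cells where "cells j = {\<phi> j..<\<phi> (Suc j)}" for j
  define G where "G k = PiE {..<q} (\<lambda>i. cells (k i))" for k
  define D where "D W g = (\<Prod>i<q. W i (\<tau>' (Suc (g i))) - W i (\<tau>' (g i)))"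
    for W :: "nat \<Rightarrow> real \<Rightarrow> real" and g
  have G_sub: "G k \<subseteq> off_diagonal q n'" if k: "k \<in> off_diagonal q n" for k
  proof
    fix g assume g: "g \<in> G k"
    have gi: "\<phi> (k i) \<le> g i" "g i < \<phi> (Suc (k i))" if "i < q" for i
      using g that by (auto simp: G_def cells_def PiE_iff)
    have "inj_on g {..<q}"
    proof (rule inj_onI)
      fix i j assume ij: "i \<in> {..<q}" "j \<in> {..<q}" "g i = g j"
      have "\<not> k i < k j" if "i < q" "j < q" "g i = g j" for i j
      proof
        assume "k i < k j"
        then have "\<phi> (Suc (k i)) \<le> \<phi> (k j)"
          using off_diagonalD(1)[OF k that(2)] by (intro mono') auto
        then show False using gi[of i] gi[of j] that by simp
      qed
      then have "k i = k j" using ij by (metis lessThan_iff nat_neq_iff)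
      then show "i = j" using off_diagonalD(2)[OF k] ij by (auto dest: inj_onD)
    qed
    moreover have "g i < n'" if "i < q" for i
      using gi[OF that] \<phi>(1)[of "Suc (k i)"] off_diagonalD(1)[OF k that] by simp
    ultimately show "g \<in> off_diagonal q n'"
      using g by (auto simp: off_diagonal_def G_def PiE_iff)
  qed
  \<comment> \<open>At most one term is nonzero, since distinct boxes are disjoint; the sum form is
    ready for exchanging the two summations.\<close>
  define a' where "a' g = (\<Sum>k\<in>off_diagonal q n. if g \<in> G k then a k else 0)" for g
  have "grid_sum W q n \<tau> a = grid_sum W q n' \<tau>' a'" for W
  proof -
    have "grid_sum W q n \<tau> a = (\<Sum>k\<in>off_diagonal q n. a k * (\<Sum>g\<in>G k. D W g))"
      unfolding grid_sum_def
    proof (intro sum.cong refl arg_cong2[where f="(*)"])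
      fix k assume k: "k \<in> off_diagonal q n"
      have "(\<Prod>i<q. W i (\<tau> (Suc (k i))) - W i (\<tau> (k i)))
          = (\<Prod>i<q. \<Sum>l\<in>cells (k i). W i (\<tau>' (Suc l)) - W i (\<tau>' l))"
      proof (intro prod.cong refl)
        fix i assume "i \<in> {..<q}"
        then have "k i < n" using off_diagonalD(1)[OF k] by simp
        then show "W i (\<tau> (Suc (k i))) - W i (\<tau> (k i))
            = (\<Sum>l\<in>cells (k i). W i (\<tau>' (Suc l)) - W i (\<tau>' l))"
          unfolding cells_def
          using sum_Suc_diff'[of "\<phi> (k i)" "\<phi> (Suc (k i))" "\<lambda>l. W i (\<tau>' l)"]
            mono'[of "k i" "Suc (k i)"] by (simp add: \<phi>)
      qed
      also have "\<dots> = (\<Sum>g\<in>G k. D W g)"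
        unfolding G_def D_def by (rule prod_sum_PiE) (auto simp: cells_def)
      finally show "(\<Prod>i<q. W i (\<tau> (Suc (k i))) - W i (\<tau> (k i))) = (\<Sum>g\<in>G k. D W g)" .
    qed
    also have "\<dots> = (\<Sum>k\<in>off_diagonal q n. \<Sum>g\<in>off_diagonal q n'. (if g \<in> G k then a k else 0) * D W g)"
    proof (intro sum.cong refl)
      fix k assume "k \<in> off_diagonal q n"
      then have "(\<Sum>g\<in>G k. D W g) = (\<Sum>g\<in>off_diagonal q n'. if g \<in> G k then D W g else 0)"
        using G_sub by (subst sum.inter_restrict[OF finite_off_diagonal, symmetric]) (simp add: Int_absorb1)
      then show "a k * (\<Sum>g\<in>G k. D W g)
          = (\<Sum>g\<in>off_diagonal q n'. (if g \<in> G k then a k else 0) * D W g)"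
        by (simp add: sum_distrib_left if_distrib cong: if_cong) (rule sum.cong; simp)
    qed
    also have "\<dots> = grid_sum W q n' \<tau>' a'"
      by (subst sum.swap) (simp add: grid_sum_def a'_def D_def sum_distrib_right)
    finally show ?thesis .
  qed
  then show ?thesis by blast
qed

lemma finite_set_grid:
  fixes T :: "real set"
  assumes "finite T" "T \<noteq> {}"
  obtains n \<tau> where "strict_mono_on {..n :: nat} \<tau>" "\<tau> ` {..n} = T"
proof
  let ?l = "sorted_list_of_set T"
  have len: "length ?l = Suc (card T - 1)"
    using assms by (simp add: card_gt_0_iff)
  show "strict_mono_on {..card T - 1} (\<lambda>i. ?l ! i)"
    using strict_sorted_list_of_set[of T] len
    by (auto simp: strict_mono_on_def sorted_wrt_iff_nth_less)
  have "(\<lambda>i. ?l ! i) ` {..<length ?l} = set ?l"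
    by (auto simp: set_conv_nth)
  then show "(\<lambda>i. ?l ! i) ` {..card T - 1} = T"
    using assms by (simp only: len lessThan_Suc_atMost set_sorted_list_of_set)
qed

lemma common_grid:
  assumes "strict_mono_on {..n\<^sub>1} \<tau>\<^sub>1" "strict_mono_on {..n\<^sub>2} \<tau>\<^sub>2"
  obtains n \<tau> a b where "strict_mono_on {..n} \<tau>"
    "\<And>W. grid_sum W q n\<^sub>1 \<tau>\<^sub>1 a\<^sub>1 = grid_sum W q n \<tau> a"
    "\<And>W. grid_sum W q n\<^sub>2 \<tau>\<^sub>2 a\<^sub>2 = grid_sum W q n \<tau> b"
proof -
  obtain n \<tau> where \<tau>: "strict_mono_on {..n :: nat} \<tau>" "\<tau> ` {..n} = \<tau>\<^sub>1 ` {..n\<^sub>1} \<union> \<tau>\<^sub>2 ` {..n\<^sub>2}"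
    by (rule finite_set_grid[of "\<tau>\<^sub>1 ` {..n\<^sub>1} \<union> \<tau>\<^sub>2 ` {..n\<^sub>2}"]) auto
  obtain a where a: "\<And>W. grid_sum W q n\<^sub>1 \<tau>\<^sub>1 a\<^sub>1 = grid_sum W q n \<tau> a"
    using grid_sum_refine[OF assms(1) \<tau>(1)] \<tau>(2) by blast
  obtain b where b: "\<And>W. grid_sum W q n\<^sub>2 \<tau>\<^sub>2 a\<^sub>2 = grid_sum W q n \<tau> b"
    using grid_sum_refine[OF assms(2) \<tau>(1)] \<tau>(2) by blast
  show ?thesis by (rule that[OF \<tau>(1) a b])
qed

text \<open>Both summands are rewritten on the union of the two grids, and the coefficients found
  there serve the function and the integral alike.\<close>

lemma elementary_linear:
  assumes "strict_mono_on {..n\<^sub>1} \<tau>\<^sub>1" "strict_mono_on {..n\<^sub>2} \<tau>\<^sub>2"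
  obtains n \<tau> a where "strict_mono_on {..n} \<tau>"
    "\<And>y. elementary_fun q n \<tau> a y
       = \<alpha> * elementary_fun q n\<^sub>1 \<tau>\<^sub>1 a\<^sub>1 y + \<beta> * elementary_fun q n\<^sub>2 \<tau>\<^sub>2 a\<^sub>2 y"
    "\<And>\<omega>. elementary_integral B q n \<tau> a \<omega>
       = \<alpha> * elementary_integral B q n\<^sub>1 \<tau>\<^sub>1 a\<^sub>1 \<omega> + \<beta> * elementary_integral B q n\<^sub>2 \<tau>\<^sub>2 a\<^sub>2 \<omega>"
proof -
  obtain n \<tau> a b where *: "strict_mono_on {..n} \<tau>"
    "\<And>W. grid_sum W q n\<^sub>1 \<tau>\<^sub>1 a\<^sub>1 = grid_sum W q n \<tau> a"
    "\<And>W. grid_sum W q n\<^sub>2 \<tau>\<^sub>2 a\<^sub>2 = grid_sum W q n \<tau> b"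
    using common_grid[OF assms] by metis
  show ?thesis
    by (rule that[of n \<tau> "\<lambda>k. \<alpha> * a k + \<beta> * b k"])
      (simp_all add: elementary_fun_grid_sum elementary_integral_grid_sum assms * grid_sum_linear)
qed

text \<open>Distinct multi-indices differ in some coordinate and select disjoint half-open cells
  there, so mixed products vanish pointwise.\<close>

lemma elementary_fun_square:
  assumes "strict_mono_on {..n} \<tau>"
  shows "(elementary_fun q n \<tau> a y)\<^sup>2
    = (\<Sum>k\<in>off_diagonal q n. (a k)\<^sup>2 * (\<Prod>i<q. indicator {\<tau> (k i)<..\<tau> (Suc (k i))} (y i)))"
proof -
  let ?I = "\<lambda>k. \<Prod>i<q. indicator {\<tau> (k i)<..\<tau> (Suc (k i))} (y i) :: real"
  let ?O = "off_diagonal q n"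
  have zero: "?I k * ?I l = 0" if kl: "k \<in> ?O" "l \<in> ?O" "k \<noteq> l" for k l
  proof -
    obtain i where i: "i < q" "k i \<noteq> l i"
      using kl off_diagonalD(3) by (metis extensionalityI lessThan_iff)
    have disj: "\<tau> (Suc u) \<le> \<tau> v" if "u < v" "v < n" for u v
      using assms that by (cases "Suc u = v") (auto simp: strict_mono_on_def less_imp_le)
    have "indicator {\<tau> (k i)<..\<tau> (Suc (k i))} (y i) * indicator {\<tau> (l i)<..\<tau> (Suc (l i))} (y i) = (0::real)"
      using disj[of "k i" "l i"] disj[of "l i" "k i"] i off_diagonalD(1)[OF kl(1) i(1)]
        off_diagonalD(1)[OF kl(2) i(1)]
      by (auto simp: indicator_def nat_neq_iff)
    then have "indicator {\<tau> (k i)<..\<tau> (Suc (k i))} (y i) = (0::real)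
        \<or> indicator {\<tau> (l i)<..\<tau> (Suc (l i))} (y i) = (0::real)" by simp
    then have "?I k = 0 \<or> ?I l = 0"
      using i(1) by (elim disj_forward) (rule prod_zero, auto)+
    then show ?thesis by auto
  qed
  have sq: "?I k * ?I k = ?I k" for k
    by (simp add: prod.distrib[symmetric] indicator_inter_arith[symmetric])
  have "(elementary_fun q n \<tau> a y)\<^sup>2 = (\<Sum>k\<in>?O. \<Sum>l\<in>?O. (a k * ?I k) * (a l * ?I l))"
    by (simp add: elementary_fun_def power2_eq_square sum_product)
  also have "\<dots> = (\<Sum>k\<in>?O. \<Sum>l\<in>?O. if l = k then (a k)\<^sup>2 * ?I k else 0)"
  proof (intro sum.cong refl)
    fix k l assume "k \<in> ?O" "l \<in> ?O"
    then show "(a k * ?I k) * (a l * ?I l) = (if l = k then (a k)\<^sup>2 * ?I k else 0)"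
      using zero[of k l] sq[of k] by (auto simp: power2_eq_square algebra_simps)
  qed
  also have "\<dots> = (\<Sum>k\<in>?O. (a k)\<^sup>2 * ?I k)"
    by (simp add: finite_off_diagonal)
  finally show ?thesis .
qed

lemma box_integral:
  assumes "strict_mono_on {..n} \<tau>" "k \<in> off_diagonal q n"
  shows "has_bochner_integral (lebesgue_pow q)
    (\<lambda>y. \<Prod>i<q. indicator {\<tau> (k i)<..\<tau> (Suc (k i))} (y i) :: real)
    (\<Prod>i<q. \<tau> (Suc (k i)) - \<tau> (k i))"
proof -
  interpret product_sigma_finite "\<lambda>_::nat. lborel :: real measure" by standard
  have le: "\<tau> (k i) \<le> \<tau> (Suc (k i))" if "i < q" for i
    using grid_less[OF assms(1) off_diagonalD(1)[OF assms(2) that]] by simp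
  have int: "integrable lborel (indicator {s<..t} :: real \<Rightarrow> real)" for s t :: real
    by (cases "s \<le> t") auto
  have "(\<integral>y. (\<Prod>i<q. indicator {\<tau> (k i)<..\<tau> (Suc (k i))} (y i) :: real) \<partial>lebesgue_pow q)
      = (\<Prod>i<q. \<integral>x. indicator {\<tau> (k i)<..\<tau> (Suc (k i))} x \<partial>lborel)"
    using int by (intro product_integral_prod) auto
  also have "\<dots> = (\<Prod>i<q. \<tau> (Suc (k i)) - \<tau> (k i))"
    by (intro prod.cong) (auto simp: le)
  finally show ?thesis
    using product_integrable_prod[of "{..<q}" "\<lambda>i. indicator {\<tau> (k i)<..\<tau> (Suc (k i))} :: real \<Rightarrow> real"] int
    by (simp add: has_bochner_integral_iff)
qed

lemma elementary_fun_measurable: "elementary_fun q n \<tau> a \<in> borel_measurable (lebesgue_pow q)"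
  unfolding elementary_fun_def[abs_def]
  by (intro borel_measurable_sum borel_measurable_times borel_measurable_const borel_measurable_prod
      measurable_compose[OF measurable_component_singleton borel_measurable_indicator]) auto

lemma elementary_fun_norm:
  assumes "strict_mono_on {..n} \<tau>"
  shows "has_bochner_integral (lebesgue_pow q) (\<lambda>y. (elementary_fun q n \<tau> a y)\<^sup>2)
    (\<Sum>k\<in>off_diagonal q n. (a k)\<^sup>2 * (\<Prod>i<q. \<tau> (Suc (k i)) - \<tau> (k i)))"
  unfolding elementary_fun_square[OF assms]
  by (intro has_bochner_integral_sum has_bochner_integral_mult_right box_integral[OF assms])

text \<open>For injective \<open>k\<close> the product of increments depends only on the set of
  cells used, so the coefficients of all orderings of one set are added up: symmetrisation without
  the factor 1/q!. This turns the integral into a \<open>multilinear\<close> polynomial.\<close>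

definition image_coeff :: "nat \<Rightarrow> nat \<Rightarrow> ((nat \<Rightarrow> nat) \<Rightarrow> real) \<Rightarrow> nat set \<Rightarrow> real" where
  "image_coeff q n a S = (\<Sum>k | k \<in> off_diagonal q n \<and> k ` {..<q} = S. a k)"

lemma off_diagonal_sum_multilinear:
  "(\<Sum>k\<in>off_diagonal q n. a k * (\<Prod>i<q. x (k i))) = multilinear x n (image_coeff q n a)"
proof -
  have "multilinear x n (image_coeff q n a) =
     (\<Sum>S\<in>Pow {..<n}. \<Sum>k | k \<in> off_diagonal q n \<and> k ` {..<q} = S. a k * (\<Prod>i<q. x (k i)))"
    unfolding multilinear_def image_coeff_def sum_distrib_right
  proof (intro sum.cong refl)
    fix S k assume "k \<in> {k. k \<in> off_diagonal q n \<and> k ` {..<q} = S}"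
    then have "(\<Prod>j\<in>S. x j) = (\<Prod>i<q. x (k i))"
      using off_diagonalD(2)[of k q n] by (auto simp: prod.reindex)
    then show "a k * (\<Prod>j\<in>S. x j) = a k * (\<Prod>i<q. x (k i))" by simp
  qed
  also have "\<dots> = (\<Sum>k\<in>off_diagonal q n. a k * (\<Prod>i<q. x (k i)))"
    by (rule sum.group) (auto simp: finite_off_diagonal dest: off_diagonalD)
  finally show ?thesis by simp
qed

lemma image_coeff_degree: "card S > q \<Longrightarrow> image_coeff q n a S = 0"
  unfolding image_coeff_def
  by (rule sum.neutral) (auto simp: card_image dest: off_diagonalD(2))

text \<open>Cauchy-Schwarz, with at most q^q maps from \<open>{..<q}\<close> to a set of q
  cells.\<close>

lemma image_coeff_square_le:
  "(image_coeff q n a S)\<^sup>2 \<le> image_coeff q n (\<lambda>k. real q ^ q * (a k)\<^sup>2) S"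
proof -
  let ?K = "{k. k \<in> off_diagonal q n \<and> k ` {..<q} = S}"
  have card: "card ?K \<le> q ^ q"
  proof (cases "?K = {}")
    case False
    then obtain k where "k \<in> off_diagonal q n" "k ` {..<q} = S" by auto
    then have S: "card S = q" "finite S" by (auto simp: card_image dest: off_diagonalD(2))
    have "?K \<subseteq> {..<q} \<rightarrow>\<^sub>E S" by (auto simp: off_diagonal_def PiE_def)
    then have "card ?K \<le> card ({..<q} \<rightarrow>\<^sub>E S)"
      using S by (intro card_mono finite_PiE) auto
    then show ?thesis using S by (simp add: card_PiE)
  qed (metis card.empty zero_le)
  have "(image_coeff q n a S)\<^sup>2 \<le> (\<Sum>k\<in>?K. (a k)\<^sup>2) * card ?K"
    unfolding image_coeff_def by (rule sum_squared_le_sum_of_squares)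
  also have "\<dots> \<le> (\<Sum>k\<in>?K. (a k)\<^sup>2) * real (q ^ q)"
    using card by (intro mult_left_mono) (auto intro: sum_nonneg)
  finally show ?thesis by (simp add: image_coeff_def sum_distrib_left sum_distrib_right mult.commute)
qed

text \<open>With cell lengths for \<open>v\<close>, the left side is the second moment of the
  elementary integral and the sum on the right is the squared L^2 norm of the elementary function.
  This plays the part of the Wiener-Ito bound, with q^q in the place of q!.\<close>

lemma multilinear_image_coeff_square_le:
  assumes "\<And>j. j < n \<Longrightarrow> v j \<ge> 0"
  shows "multilinear v n (\<lambda>S. (image_coeff q n a S)\<^sup>2)
    \<le> real q ^ q * (\<Sum>k\<in>off_diagonal q n. (a k)\<^sup>2 * (\<Prod>i<q. v (k i)))"
proof -
  have "multilinear v n (\<lambda>S. (image_coeff q n a S)\<^sup>2)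
      \<le> multilinear v n (image_coeff q n (\<lambda>k. real q ^ q * (a k)\<^sup>2))"
    unfolding multilinear_def
    by (intro sum_mono mult_right_mono image_coeff_square_le prod_nonneg) (auto intro: assms)
  also have "\<dots> = real q ^ q * (\<Sum>k\<in>off_diagonal q n. (a k)\<^sup>2 * (\<Prod>i<q. v (k i)))"
    by (simp add: off_diagonal_sum_multilinear[symmetric] sum_distrib_left mult.assoc)
  finally show ?thesis .
qed

section \<open>Square integrable functions\<close>

lemma square_le_weighted: "(a * x + b * y)\<^sup>2 \<le> 2 * a\<^sup>2 * x\<^sup>2 + 2 * b\<^sup>2 * y\<^sup>2" for a b x y :: real
  using sum_squares_bound[of "a * x" "b * y"] by (simp add: power2_sum power_mult_distrib)

lemma square_integrable_linear:
  assumes "square_integrable M f" "square_integrable M g"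
  shows "square_integrable M (\<lambda>x. a * f x + b * g x)"
    and "(\<integral>x. (a * f x + b * g x)\<^sup>2 \<partial>M) \<le> 2 * a\<^sup>2 * (\<integral>x. (f x)\<^sup>2 \<partial>M) + 2 * b\<^sup>2 * (\<integral>x. (g x)\<^sup>2 \<partial>M)"
proof -
  note [measurable] = assms[unfolded square_integrable_def, THEN conjunct1]
  have int: "integrable M (\<lambda>x. (f x)\<^sup>2)" "integrable M (\<lambda>x. (g x)\<^sup>2)"
    using assms by (auto simp: square_integrable_def)
  have bound: "integrable M (\<lambda>x. 2 * a\<^sup>2 * (f x)\<^sup>2 + 2 * b\<^sup>2 * (g x)\<^sup>2)"
    using int by simp
  have int': "integrable M (\<lambda>x. (a * f x + b * g x)\<^sup>2)"
  proof (rule Bochner_Integration.integrable_bound[OF bound])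
    show "AE x in M. norm ((a * f x + b * g x)\<^sup>2) \<le> norm (2 * a\<^sup>2 * (f x)\<^sup>2 + 2 * b\<^sup>2 * (g x)\<^sup>2)"
    proof (rule AE_I2)
      fix x
      show "norm ((a * f x + b * g x)\<^sup>2) \<le> norm (2 * a\<^sup>2 * (f x)\<^sup>2 + 2 * b\<^sup>2 * (g x)\<^sup>2)"
        using square_le_weighted[of a "f x" b "g x"] by simp
    qed
  qed measurable
  then show "square_integrable M (\<lambda>x. a * f x + b * g x)"
    by (simp add: square_integrable_def)
  have "(\<integral>x. (a * f x + b * g x)\<^sup>2 \<partial>M) \<le> (\<integral>x. 2 * a\<^sup>2 * (f x)\<^sup>2 + 2 * b\<^sup>2 * (g x)\<^sup>2 \<partial>M)"
    by (rule integral_mono[OF int' bound square_le_weighted])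
  also have "\<dots> = 2 * a\<^sup>2 * (\<integral>x. (f x)\<^sup>2 \<partial>M) + 2 * b\<^sup>2 * (\<integral>x. (g x)\<^sup>2 \<partial>M)"
    using int by simp
  finally show "(\<integral>x. (a * f x + b * g x)\<^sup>2 \<partial>M)
    \<le> 2 * a\<^sup>2 * (\<integral>x. (f x)\<^sup>2 \<partial>M) + 2 * b\<^sup>2 * (\<integral>x. (g x)\<^sup>2 \<partial>M)" .
qed

lemma square_integrable_diff:
  assumes "square_integrable M f" "square_integrable M g"
  shows "square_integrable M (\<lambda>x. f x - g x)"
  using square_integrable_linear(1)[OF assms, of 1 "-1"] by simp

lemma L2_tendsto_linear:
  assumes f: "square_integrable M f" "\<And>m :: nat. square_integrable M (F m)"
    and g: "square_integrable M g" "\<And>m. square_integrable M (G m)"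
    and F: "(\<lambda>m. \<integral>x. (F m x - f x)\<^sup>2 \<partial>M) \<longlonglongrightarrow> 0"
    and G: "(\<lambda>m. \<integral>x. (G m x - g x)\<^sup>2 \<partial>M) \<longlonglongrightarrow> 0"
  shows "(\<lambda>m. \<integral>x. ((a * F m x + b * G m x) - (a * f x + b * g x))\<^sup>2 \<partial>M) \<longlonglongrightarrow> 0"
proof (rule tendsto_sandwich)
  show "\<forall>\<^sub>F m in sequentially. 0 \<le> (\<integral>x. ((a * F m x + b * G m x) - (a * f x + b * g x))\<^sup>2 \<partial>M)"
    by simp
  have eq: "(a * F m x + b * G m x) - (a * f x + b * g x) = a * (F m x - f x) + b * (G m x - g x)" for m x
    by (simp add: algebra_simps)
  show "\<forall>\<^sub>F m in sequentially. (\<integral>x. ((a * F m x + b * G m x) - (a * f x + b * g x))\<^sup>2 \<partial>M)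
     \<le> 2 * a\<^sup>2 * (\<integral>x. (F m x - f x)\<^sup>2 \<partial>M) + 2 * b\<^sup>2 * (\<integral>x. (G m x - g x)\<^sup>2 \<partial>M)"
    unfolding eq
    by (intro always_eventually allI square_integrable_linear(2) square_integrable_diff f g)
  show "(\<lambda>m. 2 * a\<^sup>2 * (\<integral>x. (F m x - f x)\<^sup>2 \<partial>M) + 2 * b\<^sup>2 * (\<integral>x. (G m x - g x)\<^sup>2 \<partial>M)) \<longlonglongrightarrow> 0"
    by (rule tendsto_eq_intros F G refl | simp)+
qed simp

lemma elementary_fun_square_integrable:
  assumes "strict_mono_on {..n} \<tau>"
  shows "square_integrable (lebesgue_pow q) (elementary_fun q n \<tau> a)"
  using elementary_fun_norm[OF assms] elementary_fun_measurable
  by (auto simp: square_integrable_def has_bochner_integral_iff)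

section \<open>Multiple Wiener integrals\<close>

context two_sided_brownian_motion
begin

lemma increment_normal:
  assumes "strict_mono_on {..n} \<tau>" "j < n"
  shows "distributed M lborel (\<lambda>\<omega>. B (\<tau> (Suc j)) \<omega> - B (\<tau> j) \<omega>)
    (normal_density 0 (sqrt (\<tau> (Suc j) - \<tau> j)))"
  by (rule normal_increments[OF grid_less[OF assms]])

lemma elementary_integral_multilinear:
  "elementary_integral B q n \<tau> a \<omega>
    = multilinear (\<lambda>j. B (\<tau> (Suc j)) \<omega> - B (\<tau> j) \<omega>) n (image_coeff q n a)"
  by (simp add: elementary_integral_def off_diagonal_sum_multilinear[symmetric])

lemma elementary_integral_all_moments:
  assumes "strict_mono_on {..n} \<tau>"
  shows "all_moments M (elementary_integral B q n \<tau> a)"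
  unfolding elementary_integral_multilinear[abs_def]
  using grid_less[OF assms]
  by (intro all_moments_multilinear normal_all_moments(1)[OF increment_normal[OF assms]]) auto

lemma elementary_integral_square_integrable:
  assumes "strict_mono_on {..n} \<tau>"
  shows "square_integrable M (elementary_integral B q n \<tau> a)"
  using elementary_integral_all_moments[OF assms]
  by (auto simp: square_integrable_def all_moments_def)

text \<open>The order of quantifiers is the point: one constant, \<open>L ^ q * real q ^ q\<close>,
  serves all grids and coefficients, so the bound survives approximation.\<close>

lemma elementary_integral_moment_le:
  "\<exists>C\<ge>0. \<forall>n \<tau> a. strict_mono_on {..n} \<tau> \<longrightarrow>
    expectation (\<lambda>\<omega>. elementary_integral B q n \<tau> a \<omega> ^ (2*r))
      \<le> (C * (\<integral>y. (elementary_fun q n \<tau> a y)\<^sup>2 \<partial>lebesgue_pow q)) ^ r"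
proof -
  obtain L where L: "L \<ge> 1"
    "\<forall>j\<in>{1..r}. 2 * (real ((2*r) choose (2*j)) * (fact (2*j) / (2 ^ j * fact j))) \<le> L"
    using moment_constant_exists by blast
  show ?thesis
  proof (intro exI[of _ "L ^ q * real q ^ q"] conjI allI impI)
    show "L ^ q * real q ^ q \<ge> 0" using L by simp
    fix n :: nat and \<tau> :: "nat \<Rightarrow> real" and a assume \<tau>: "strict_mono_on {..n} \<tau>"
    let ?v = "\<lambda>j. \<tau> (Suc j) - \<tau> j"
    have v: "?v j > 0" if "j < n" for j using grid_less[OF \<tau> that] by simp
    have "expectation (\<lambda>\<omega>. elementary_integral B q n \<tau> a \<omega> ^ (2*r))
       \<le> (L ^ q * multilinear ?v n (\<lambda>S. (image_coeff q n a S)\<^sup>2)) ^ r"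
      unfolding elementary_integral_multilinear
      by (rule hypercontractivity[OF L indep_increments[OF \<tau>] v increment_normal[OF \<tau>] order_refl])
        (auto intro: image_coeff_degree)
    also have "\<dots> \<le> (L ^ q * (real q ^ q * (\<Sum>k\<in>off_diagonal q n. (a k)\<^sup>2 * (\<Prod>i<q. ?v (k i))))) ^ r"
      using L v less_imp_le[OF v]
      by (intro power_mono mult_left_mono multilinear_image_coeff_square_le mult_nonneg_nonneg
          multilinear_nonneg) auto
    also have "\<dots> = (L ^ q * real q ^ q * (\<integral>y. (elementary_fun q n \<tau> a y)\<^sup>2 \<partial>lebesgue_pow q)) ^ r"
      using elementary_fun_norm[OF \<tau>] by (simp add: has_bochner_integral_iff mult.assoc)
    finally show "expectation (\<lambda>\<omega>. elementary_integral B q n \<tau> a \<omega> ^ (2*r))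
      \<le> (L ^ q * real q ^ q * (\<integral>y. (elementary_fun q n \<tau> a y)\<^sup>2 \<partial>lebesgue_pow q)) ^ r" .
  qed
qed

lemma wiener_integral_elementary:
  assumes "strict_mono_on {..n} \<tau>"
  shows "has_multiple_wiener_integral M B q (elementary_fun q n \<tau> a) (elementary_integral B q n \<tau> a)"
  unfolding has_multiple_wiener_integral_def
  by (intro conjI elementary_fun_square_integrable[OF assms] elementary_integral_square_integrable[OF assms]
      exI[of _ "\<lambda>_. n"] exI[of _ "\<lambda>_. \<tau>"] exI[of _ "\<lambda>_. a"]) (use assms in auto)

lemma wiener_integralE:
  assumes "has_multiple_wiener_integral M B q f X"
  obtains n \<tau> a where "\<And>m :: nat. strict_mono_on {..n m} (\<tau> m)"
    "(\<lambda>m. \<integral>y. (elementary_fun q (n m) (\<tau> m) (a m) y - f y)\<^sup>2 \<partial>lebesgue_pow q) \<longlonglongrightarrow> 0"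
    "(\<lambda>m. \<integral>\<omega>. (elementary_integral B q (n m) (\<tau> m) (a m) \<omega> - X \<omega>)\<^sup>2 \<partial>M) \<longlonglongrightarrow> 0"
  using assms unfolding has_multiple_wiener_integral_def
  by (elim conjE exE) (rule that, erule spec, assumption+)

text \<open>The \<open>m\<close>-th approximants of both integrals are put on a common grid and
  combined; L^2 convergence passes to linear combinations.\<close>

lemma wiener_integral_linear:
  assumes "has_multiple_wiener_integral M B q f X" "has_multiple_wiener_integral M B q g Y"
  shows "has_multiple_wiener_integral M B q (\<lambda>y. \<alpha> * f y + \<beta> * g y) (\<lambda>\<omega>. \<alpha> * X \<omega> + \<beta> * Y \<omega>)"
proof -
  obtain n\<^sub>1 \<tau>\<^sub>1 a\<^sub>1 where 1: "\<And>m :: nat. strict_mono_on {..n\<^sub>1 m} (\<tau>\<^sub>1 m)"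
      "(\<lambda>m. \<integral>y. (elementary_fun q (n\<^sub>1 m) (\<tau>\<^sub>1 m) (a\<^sub>1 m) y - f y)\<^sup>2 \<partial>lebesgue_pow q) \<longlonglongrightarrow> 0"
      "(\<lambda>m. \<integral>\<omega>. (elementary_integral B q (n\<^sub>1 m) (\<tau>\<^sub>1 m) (a\<^sub>1 m) \<omega> - X \<omega>)\<^sup>2 \<partial>M) \<longlonglongrightarrow> 0"
    by (rule wiener_integralE[OF assms(1)]) blast
  obtain n\<^sub>2 \<tau>\<^sub>2 a\<^sub>2 where 2: "\<And>m :: nat. strict_mono_on {..n\<^sub>2 m} (\<tau>\<^sub>2 m)"
      "(\<lambda>m. \<integral>y. (elementary_fun q (n\<^sub>2 m) (\<tau>\<^sub>2 m) (a\<^sub>2 m) y - g y)\<^sup>2 \<partial>lebesgue_pow q) \<longlonglongrightarrow> 0"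
      "(\<lambda>m. \<integral>\<omega>. (elementary_integral B q (n\<^sub>2 m) (\<tau>\<^sub>2 m) (a\<^sub>2 m) \<omega> - Y \<omega>)\<^sup>2 \<partial>M) \<longlonglongrightarrow> 0"
    by (rule wiener_integralE[OF assms(2)]) blast
  have sq: "square_integrable (lebesgue_pow q) f" "square_integrable M X"
      "square_integrable (lebesgue_pow q) g" "square_integrable M Y"
    using assms by (auto simp: has_multiple_wiener_integral_def)
  have "\<forall>m. \<exists>n \<tau> a. strict_mono_on {..n} \<tau> \<and>
      (\<forall>y. elementary_fun q n \<tau> a y
        = \<alpha> * elementary_fun q (n\<^sub>1 m) (\<tau>\<^sub>1 m) (a\<^sub>1 m) y + \<beta> * elementary_fun q (n\<^sub>2 m) (\<tau>\<^sub>2 m) (a\<^sub>2 m) y) \<and>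
      (\<forall>\<omega>. elementary_integral B q n \<tau> a \<omega>
        = \<alpha> * elementary_integral B q (n\<^sub>1 m) (\<tau>\<^sub>1 m) (a\<^sub>1 m) \<omega>
          + \<beta> * elementary_integral B q (n\<^sub>2 m) (\<tau>\<^sub>2 m) (a\<^sub>2 m) \<omega>)"
    by (rule allI, rule elementary_linear[OF 1(1) 2(1)]) blast
  then obtain n \<tau> a where 3: "\<And>m :: nat. strict_mono_on {..n m} (\<tau> m)"
      "\<And>m y. elementary_fun q (n m) (\<tau> m) (a m) y
        = \<alpha> * elementary_fun q (n\<^sub>1 m) (\<tau>\<^sub>1 m) (a\<^sub>1 m) y + \<beta> * elementary_fun q (n\<^sub>2 m) (\<tau>\<^sub>2 m) (a\<^sub>2 m) y"
      "\<And>m \<omega>. elementary_integral B q (n m) (\<tau> m) (a m) \<omega>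
        = \<alpha> * elementary_integral B q (n\<^sub>1 m) (\<tau>\<^sub>1 m) (a\<^sub>1 m) \<omega>
          + \<beta> * elementary_integral B q (n\<^sub>2 m) (\<tau>\<^sub>2 m) (a\<^sub>2 m) \<omega>"
    unfolding choice_iff by (elim exE) (rule that; blast)
  show ?thesis
    unfolding has_multiple_wiener_integral_def
  proof (intro conjI exI[of _ n] exI[of _ \<tau>] exI[of _ a] allI 3(1))
    show "(\<lambda>m. \<integral>y. (elementary_fun q (n m) (\<tau> m) (a m) y - (\<alpha> * f y + \<beta> * g y))\<^sup>2 \<partial>lebesgue_pow q)
        \<longlonglongrightarrow> 0"
      unfolding 3(2)
      by (intro L2_tendsto_linear elementary_fun_square_integrable sq 1 2)
    show "(\<lambda>m. \<integral>\<omega>. (elementary_integral B q (n m) (\<tau> m) (a m) \<omega> - (\<alpha> * X \<omega> + \<beta> * Y \<omega>))\<^sup>2 \<partial>M)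
        \<longlonglongrightarrow> 0"
      unfolding 3(3)
      by (intro L2_tendsto_linear elementary_integral_square_integrable sq 1 2)
  qed (intro square_integrable_linear(1) sq)+
qed

text \<open>L^2 convergence of the approximants does not by itself control higher moments of
  \<open>X\<close>. Along a subsequence the convergence is almost sure, and Fatou's lemma then
  carries over the uniform bound, giving integrability and the estimate together.\<close>

lemma wiener_integral_moment_aux:
  assumes mwi: "has_multiple_wiener_integral M B q f X" and C: "C \<ge> 0"
    and bound: "\<And>n \<tau> a. strict_mono_on {..n} \<tau> \<Longrightarrow>
      expectation (\<lambda>\<omega>. elementary_integral B q n \<tau> a \<omega> ^ (2*r))
        \<le> (C * (\<integral>y. (elementary_fun q n \<tau> a y)\<^sup>2 \<partial>lebesgue_pow q)) ^ r"
  shows "integrable M (\<lambda>\<omega>. X \<omega> ^ (2*r))"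
    and "expectation (\<lambda>\<omega>. X \<omega> ^ (2*r)) \<le> (2 * C * (\<integral>y. (f y)\<^sup>2 \<partial>lebesgue_pow q)) ^ r"
proof -
  obtain n \<tau> a where 1: "\<And>m :: nat. strict_mono_on {..n m} (\<tau> m)"
      "(\<lambda>m. \<integral>y. (elementary_fun q (n m) (\<tau> m) (a m) y - f y)\<^sup>2 \<partial>lebesgue_pow q) \<longlonglongrightarrow> 0"
      "(\<lambda>m. \<integral>\<omega>. (elementary_integral B q (n m) (\<tau> m) (a m) \<omega> - X \<omega>)\<^sup>2 \<partial>M) \<longlonglongrightarrow> 0"
    by (rule wiener_integralE[OF mwi]) blast
  have sq: "square_integrable (lebesgue_pow q) f" "square_integrable M X"
    using mwi by (auto simp: has_multiple_wiener_integral_def)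
  have [measurable]: "X \<in> borel_measurable M" using sq by (simp add: square_integrable_def)
  define e where "e m = elementary_fun q (n m) (\<tau> m) (a m)" for m
  define I where "I m = elementary_integral B q (n m) (\<tau> m) (a m)" for m
  define \<delta> where "\<delta> m = (\<integral>y. (e m y - f y)\<^sup>2 \<partial>lebesgue_pow q)" for m
  define F where "F = (\<integral>y. (f y)\<^sup>2 \<partial>lebesgue_pow q)"
  have sq_e: "square_integrable (lebesgue_pow q) (e m)" and sq_I: "square_integrable M (I m)"
    and am_I: "all_moments M (I m)" for m
    unfolding e_def I_def
    by (intro elementary_fun_square_integrable elementary_integral_square_integrable
        elementary_integral_all_moments 1)+
  have [measurable]: "I m \<in> borel_measurable M" for m
    using am_I by (simp add: all_moments_measurable)
  have F: "F \<ge> 0" "\<And>m. \<delta> m \<ge> 0" by (simp_all add: F_def \<delta>_def)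
  \<comment> \<open>From (x + y)^2 <= 2 x^2 + 2 y^2; this is the source of the factor 2 in the final
    bound.\<close>
  have norm_e: "(\<integral>y. (e m y)\<^sup>2 \<partial>lebesgue_pow q) \<le> 2 * F + 2 * \<delta> m" for m
    using square_integrable_linear(2)[OF sq(1) square_integrable_diff[OF sq_e sq(1)], of 1 1]
    by (simp add: F_def \<delta>_def)
  have EI: "expectation (\<lambda>\<omega>. I m \<omega> ^ (2*r)) \<le> (C * (2 * F + 2 * \<delta> m)) ^ r" for m
  proof -
    have "expectation (\<lambda>\<omega>. I m \<omega> ^ (2*r)) \<le> (C * (\<integral>y. (e m y)\<^sup>2 \<partial>lebesgue_pow q)) ^ r"
      unfolding I_def e_def by (rule bound[OF 1(1)])
    also have "\<dots> \<le> (C * (2 * F + 2 * \<delta> m)) ^ r"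
      using C norm_e by (intro power_mono mult_left_mono) auto
    finally show ?thesis .
  qed
  obtain s where s: "strict_mono s" "AE \<omega> in M. (\<lambda>m. (I (s m) \<omega> - X \<omega>)\<^sup>2) \<longlonglongrightarrow> 0"
    using tendsto_L1_AE_subseq[of M "\<lambda>m \<omega>. (I m \<omega> - X \<omega>)\<^sup>2"]
      square_integrable_diff[OF sq_I sq(2)] 1(3)
    by (auto simp: square_integrable_def I_def)
  have AE_lim: "AE \<omega> in M. (\<lambda>m. ennreal (I (s m) \<omega> ^ (2*r))) \<longlonglongrightarrow> ennreal (X \<omega> ^ (2*r))"
    using s(2)
  proof eventually_elim
    case (elim \<omega>)
    then have "(\<lambda>m. sqrt ((I (s m) \<omega> - X \<omega>)\<^sup>2)) \<longlonglongrightarrow> sqrt 0" by (rule tendsto_real_sqrt)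
    then have "(\<lambda>m. I (s m) \<omega> - X \<omega>) \<longlonglongrightarrow> 0" by (simp add: tendsto_rabs_zero_iff)
    then have "(\<lambda>m. I (s m) \<omega>) \<longlonglongrightarrow> X \<omega>" by (simp add: LIM_zero_iff)
    then show ?case by (intro tendsto_ennrealI tendsto_power)
  qed
  have "(\<integral>\<^sup>+\<omega>. ennreal (X \<omega> ^ (2*r)) \<partial>M) = (\<integral>\<^sup>+\<omega>. liminf (\<lambda>m. ennreal (I (s m) \<omega> ^ (2*r))) \<partial>M)"
    using AE_lim
    by (intro nn_integral_cong_AE, eventually_elim)
      (rule lim_imp_Liminf[symmetric], rule trivial_limit_sequentially)
  also have "\<dots> \<le> liminf (\<lambda>m. \<integral>\<^sup>+\<omega>. ennreal (I (s m) \<omega> ^ (2*r)) \<partial>M)"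
    by (rule nn_integral_liminf) measurable
  also have "\<dots> \<le> liminf (\<lambda>m. ennreal ((C * (2 * F + 2 * \<delta> (s m))) ^ r))"
  proof (intro Liminf_mono always_eventually allI)
    fix m
    have "(\<integral>\<^sup>+\<omega>. ennreal (I (s m) \<omega> ^ (2*r)) \<partial>M) = ennreal (expectation (\<lambda>\<omega>. I (s m) \<omega> ^ (2*r)))"
      by (intro nn_integral_eq_integral all_moments_integrable_power am_I) simp
    then show "(\<integral>\<^sup>+\<omega>. ennreal (I (s m) \<omega> ^ (2*r)) \<partial>M) \<le> ennreal ((C * (2 * F + 2 * \<delta> (s m))) ^ r)"
      using EI by (simp add: ennreal_leI)
  qed
  also have "\<dots> = ennreal ((C * (2 * F + 2 * 0)) ^ r)"
  proof (intro lim_imp_Liminf tendsto_ennrealI tendsto_intros)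
    show "(\<lambda>m. \<delta> (s m)) \<longlonglongrightarrow> 0"
      using LIMSEQ_subseq_LIMSEQ[OF 1(2) s(1)] by (simp add: \<delta>_def e_def comp_def)
  qed simp
  finally have nn: "(\<integral>\<^sup>+\<omega>. ennreal (X \<omega> ^ (2*r)) \<partial>M) \<le> ennreal ((2 * C * F) ^ r)"
    by (simp add: mult.commute mult.left_commute)
  show int: "integrable M (\<lambda>\<omega>. X \<omega> ^ (2*r))"
    by (rule integrableI_nonneg)
      (use nn in \<open>auto intro: le_less_trans simp: zero_le_even_power\<close>)
  have "ennreal (expectation (\<lambda>\<omega>. X \<omega> ^ (2*r))) = (\<integral>\<^sup>+\<omega>. ennreal (X \<omega> ^ (2*r)) \<partial>M)"
    by (rule nn_integral_eq_integral[symmetric, OF int]) simp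
  with nn have "ennreal (expectation (\<lambda>\<omega>. X \<omega> ^ (2*r))) \<le> ennreal ((2 * C * F) ^ r)" by simp
  then show "expectation (\<lambda>\<omega>. X \<omega> ^ (2*r)) \<le> (2 * C * (\<integral>y. (f y)\<^sup>2 \<partial>lebesgue_pow q)) ^ r"
    using C F by (simp add: F_def[symmetric])
qed

lemma wiener_integral_all_moments:
  assumes "has_multiple_wiener_integral M B q f X"
  shows "all_moments M X"
proof (rule all_momentsI_even)
  show "X \<in> borel_measurable M"
    using assms by (simp add: has_multiple_wiener_integral_def square_integrable_def)
  fix r :: nat
  obtain C where C: "C \<ge> 0" "\<And>n \<tau> a. strict_mono_on {..n} \<tau> \<Longrightarrow>
    expectation (\<lambda>\<omega>. elementary_integral B q n \<tau> a \<omega> ^ (2*r))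
      \<le> (C * (\<integral>y. (elementary_fun q n \<tau> a y)\<^sup>2 \<partial>lebesgue_pow q)) ^ r"
    using elementary_integral_moment_le[where q=q and r=r] by blast
  show "integrable M (\<lambda>\<omega>. X \<omega> ^ (2*r))"
    by (rule wiener_integral_moment_aux(1)[OF assms C])
qed

lemma wiener_integral_moment_le:
  "\<exists>C\<ge>0. \<forall>f X. has_multiple_wiener_integral M B q f X \<longrightarrow>
    expectation (\<lambda>\<omega>. X \<omega> ^ (2*r)) \<le> (C * (\<integral>y. (f y)\<^sup>2 \<partial>lebesgue_pow q)) ^ r"
proof -
  obtain C where C: "C \<ge> 0" "\<And>n \<tau> a. strict_mono_on {..n} \<tau> \<Longrightarrow>
    expectation (\<lambda>\<omega>. elementary_integral B q n \<tau> a \<omega> ^ (2*r))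
      \<le> (C * (\<integral>y. (elementary_fun q n \<tau> a y)\<^sup>2 \<partial>lebesgue_pow q)) ^ r"
    using elementary_integral_moment_le[where q=q and r=r] by blast
  have "has_multiple_wiener_integral M B q f X \<Longrightarrow>
    expectation (\<lambda>\<omega>. X \<omega> ^ (2*r)) \<le> (2 * C * (\<integral>y. (f y)\<^sup>2 \<partial>lebesgue_pow q)) ^ r" for f X
    by (rule wiener_integral_moment_aux(2)[OF _ C])
  with C(1) show ?thesis by (intro exI[of _ "2 * C"]) auto
qed

end

section \<open>Scaling of the Hermite kernel\<close>

text \<open>Restriction keeps the point in the space of the finite product measure, whose elements
  are \<open>undefined\<close> outside \<open>{..<q}\<close>.\<close>

definition affine_pow :: "nat \<Rightarrow> real \<Rightarrow> real \<Rightarrow> (nat \<Rightarrow> real) \<Rightarrow> nat \<Rightarrow> real" where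
  "affine_pow q t h y = (\<lambda>i\<in>{..<q}. (y i - t) / h)"

lemma affine_pow_measurable [measurable]: "affine_pow q t h \<in> measurable (lebesgue_pow q) (lebesgue_pow q)"
  unfolding affine_pow_def[abs_def]
  by (intro measurable_restrict borel_measurable_divide borel_measurable_diff borel_measurable_const
      measurable_compose[OF measurable_component_singleton]) auto

lemma emeasure_lborel_affine:
  assumes "h > 0" and A: "A \<in> sets borel"
  shows "emeasure lborel A = ennreal (1 / h) * emeasure lborel ((\<lambda>x. (x - t) / h) -` A)"
proof -
  have "emeasure lborel A
      = emeasure (density (distr lborel borel (\<lambda>x. - t / h + 1 / h * x)) (\<lambda>_. \<bar>1 / h\<bar>)) A"
    using lborel_real_affine[of "1 / h" "- t / h"] assms by simp
  also have "\<dots> = ennreal (1 / h) * emeasure (distr lborel borel (\<lambda>x. - t / h + 1 / h * x)) A"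
    using assms by (simp add: emeasure_density_const)
  also have "emeasure (distr lborel borel (\<lambda>x. - t / h + 1 / h * x)) A
      = emeasure lborel ((\<lambda>x. - t / h + 1 / h * x) -` A)"
    using A by (subst emeasure_distr) auto
  also have "(\<lambda>x. - t / h + 1 / h * x) = (\<lambda>x. (x - t) / h)"
    by (simp add: fun_eq_iff diff_divide_distrib)
  finally show ?thesis .
qed

text \<open>Both measures agree on boxes, where the scaling acts coordinate by coordinate and
  produces \<open>q\<close> factors \<open>1 / h\<close>.\<close>

lemma lebesgue_pow_affine:
  assumes h: "h > 0"
  shows "density (distr (lebesgue_pow q) (lebesgue_pow q) (affine_pow q t h)) (\<lambda>_. ennreal (1 / h ^ q))
    = lebesgue_pow q"
proof -
  interpret product_sigma_finite "\<lambda>_::nat. lborel :: real measure" by standard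
  let ?D = "distr (lebesgue_pow q) (lebesgue_pow q) (affine_pow q t h)"
  show ?thesis
  proof (rule PiM_eqI)
    fix A :: "nat \<Rightarrow> real set" assume A: "\<And>i. i \<in> {..<q} \<Longrightarrow> A i \<in> sets lborel"
    have vim: "(\<lambda>x. (x - t) / h) -` A i \<in> sets lborel" if "i \<in> {..<q}" for i
      using measurable_sets[of "\<lambda>x. (x - t) / h" borel borel "A i"] A[OF that] by simp
    have box: "Pi\<^sub>E {..<q} A \<in> sets (lebesgue_pow q)"
      using A by (intro sets_PiM_I_finite) auto
    have "emeasure (density ?D (\<lambda>_. ennreal (1 / h ^ q))) (Pi\<^sub>E {..<q} A)
        = ennreal (1 / h ^ q) * emeasure ?D (Pi\<^sub>E {..<q} A)"
      using box by (intro emeasure_density_const) simp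
    also have "emeasure ?D (Pi\<^sub>E {..<q} A)
        = emeasure (lebesgue_pow q) (affine_pow q t h -` Pi\<^sub>E {..<q} A \<inter> space (lebesgue_pow q))"
      using box by (intro emeasure_distr) simp_all
    also have "affine_pow q t h -` Pi\<^sub>E {..<q} A \<inter> space (lebesgue_pow q)
        = Pi\<^sub>E {..<q} (\<lambda>i. (\<lambda>x. (x - t) / h) -` A i)"
      by (auto simp: affine_pow_def space_PiM PiE_iff)
    also have "emeasure (lebesgue_pow q) \<dots> = (\<Prod>i<q. emeasure lborel ((\<lambda>x. (x - t) / h) -` A i))"
      using vim by (intro emeasure_PiM) auto
    also have "ennreal (1 / h ^ q) * \<dots> = (\<Prod>i<q. ennreal (1 / h) * emeasure lborel ((\<lambda>x. (x - t) / h) -` A i))"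
      using h by (simp add: prod.distrib ennreal_power power_one_over)
    also have "\<dots> = (\<Prod>i<q. emeasure lborel (A i))"
      using A h by (intro prod.cong refl emeasure_lborel_affine[symmetric]) auto
    finally show "emeasure (density ?D (\<lambda>_. ennreal (1 / h ^ q))) (Pi\<^sub>E {..<q} A)
        = (\<Prod>i<q. emeasure lborel (A i))" .
  qed simp_all
qed

lemma lebesgue_pow_integral_affine:
  fixes F :: "(nat \<Rightarrow> real) \<Rightarrow> real"
  assumes h: "h > 0" and F: "F \<in> borel_measurable (lebesgue_pow q)"
  shows "(\<integral>y. F (affine_pow q t h y) \<partial>lebesgue_pow q) = h ^ q * (\<integral>y. F y \<partial>lebesgue_pow q)"
proof -
  let ?D = "distr (lebesgue_pow q) (lebesgue_pow q) (affine_pow q t h)"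
  have "(\<integral>y. F y \<partial>lebesgue_pow q) = (\<integral>y. F y \<partial>density ?D (\<lambda>_. ennreal (1 / h ^ q)))"
    by (simp only: lebesgue_pow_affine[OF h])
  also have "\<dots> = (\<integral>y. (1 / h ^ q) *\<^sub>R F y \<partial>?D)"
    using F h by (intro integral_density) auto
  also have "\<dots> = (1 / h ^ q) * (\<integral>y. F (affine_pow q t h y) \<partial>lebesgue_pow q)"
    using F by (simp add: integral_distr)
  finally show ?thesis using h by simp
qed

text \<open>By Fubini: with the other coordinates fixed, \<open>y i = y j\<close> leaves a single
  point for \<open>y i\<close>. The time integral in the kernel is controlled at points with
  distinct coordinates only.\<close>

lemma AE_lebesgue_pow_off_diagonal: "AE y in lebesgue_pow q. inj_on y {..<q}"
proof -
  interpret product_sigma_finite "\<lambda>_::nat. lborel :: real measure" by standard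
  have "AE y in lebesgue_pow q. y i \<noteq> y j" if ij: "i < q" "j < q" "i \<noteq> j" for i j
  proof -
    let ?f = "\<lambda>y :: nat \<Rightarrow> real. indicator {0} (y i - y j) :: ennreal"
    have ins: "insert i ({..<q} - {i}) = {..<q}" using ij by auto
    have component: "(\<lambda>y. y i) \<in> borel_measurable (lebesgue_pow q)" if "i < q" for i
      using measurable_component_singleton[of i "{..<q}" "\<lambda>_. lborel :: real measure"] that by simp
    have meas: "?f \<in> borel_measurable (lebesgue_pow q)"
      by (rule measurable_compose[OF borel_measurable_diff[OF component component]]) (simp_all add: ij)
    have "(\<integral>\<^sup>+ y. ?f y \<partial>lebesgue_pow q)
        = (\<integral>\<^sup>+ x. \<integral>\<^sup>+ z. ?f (x(i := z)) \<partial>lborel \<partial>PiM ({..<q} - {i}) (\<lambda>_. lborel))"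
      by (rule product_nn_integral_insert[of "{..<q} - {i}" i ?f, unfolded ins, OF _ _ meas]) auto
    also have "(\<lambda>x. \<integral>\<^sup>+ z. ?f (x(i := z)) \<partial>lborel) = (\<lambda>x. \<integral>\<^sup>+ z. indicator {x j} z \<partial>lborel)"
      using ij by (intro ext nn_integral_cong) (auto simp: indicator_def)
    finally have "(\<integral>\<^sup>+ y. ?f y \<partial>lebesgue_pow q) = 0" by simp
    then have "AE y in lebesgue_pow q. ?f y = 0"
      using meas by (subst (asm) nn_integral_0_iff_AE) auto
    then show ?thesis by eventually_elim (auto simp: indicator_def)
  qed
  then have "AE y in lebesgue_pow q. \<forall>i\<in>{..<q}. \<forall>j\<in>{..<q}. i \<noteq> j \<longrightarrow> y i \<noteq> y j"
    by (intro AE_finite_allI) auto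
  then show ?thesis by eventually_elim (auto simp: inj_on_def)
qed

section \<open>Convergence of the time integral and self-similarity of the kernel\<close>

lemma pos_powr_measurable [measurable]: "(\<lambda>x. pos_powr x a) \<in> borel_measurable borel"
  unfolding pos_powr_def by measurable

lemma pos_powr_nonneg: "pos_powr x a \<ge> 0"
  by (simp add: pos_powr_def)

lemma pos_powr_mult: "h > 0 \<Longrightarrow> pos_powr (h * x) a = h powr a * pos_powr x a"
  by (auto simp: pos_powr_def powr_mult zero_less_mult_iff)

lemma pos_powr_set_integrable:
  assumes "a > -1"
  shows "integrable lborel (\<lambda>u. indicator {0..T} u * pos_powr (u - c) a)"
proof -
  \<comment> \<open>After the shift x = u - c only the positive part of the range counts; the
    maximum covers the case \<open>T \<le> c\<close>.\<close>
  define W where "W = max 0 (T - c)"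
  have "(\<lambda>x. x powr a) absolutely_integrable_on {0..W}"
    using assms
    by (intro nonnegative_absolutely_integrable_1 integrable_on_powr_from_0) (auto simp: W_def)
  then have "integrable lebesgue (\<lambda>x. indicator {0..W} x * x powr a)"
    by (simp add: set_integrable_def)
  then have "integrable lborel (\<lambda>x. indicator {0..W} x * x powr a)"
    by (subst (asm) integrable_completion) auto
  then have "integrable lborel (\<lambda>x. indicator {0..W} (- c + 1 * x) * (- c + 1 * x) powr a)"
    by (rule lborel_integrable_real_affine) simp
  then show ?thesis
    by (rule Bochner_Integration.integrable_bound)
      (auto simp: pos_powr_def W_def indicator_def intro!: AE_I2)
qed

lemma hermite_integrand_measurable [measurable]:
  "(\<lambda>u. hermite_integrand d q H u y) \<in> borel_measurable borel"
  unfolding hermite_integrand_def by measurable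

text \<open>Only the largest coordinate \<open>y j\<close> produces a singularity: the product
  vanishes for u <= y_j, and beyond it the other factors are at most (y_j - y_i)^\<alpha>. Since
  (1-H)/q <= 1-H < 1/2, the remaining exponent \<alpha> exceeds -1. Were the largest coordinate
  repeated, the exponent would be at most 2\<alpha> < -1 and the integral could diverge.\<close>

lemma hermite_integrand_integrable:
  assumes q: "q \<ge> 1" and H: "1/2 < H" "H < 1" and y: "inj_on y {..<q}"
  shows "integrable lborel (\<lambda>u. indicator {0..T} u * hermite_integrand d q H u y)"
proof -
  define \<alpha> where "\<alpha> = - (1/2 + (1 - H) / real q)"
  have "(1 - H) / real q \<le> 1 - H" using q H by (simp add: divide_le_eq mult_le_cancel_left1)
  moreover have "(1 - H) / real q \<ge> 0" using H by simp
  ultimately have \<alpha>: "\<alpha> > -1" "\<alpha> < 0" using H unfolding \<alpha>_def by linarith+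
  have "Max (y ` {..<q}) \<in> y ` {..<q}" using q by (intro Max_in) (auto simp: lessThan_empty_iff)
  then obtain j where j: "j < q" "y j = Max (y ` {..<q})" by auto
  have max: "y i < y j" if "i < q" "i \<noteq> j" for i
  proof -
    have "y i \<le> y j" using that j by simp
    moreover have "y i \<noteq> y j" using y that j(1) by (auto dest: inj_onD)
    ultimately show ?thesis by simp
  qed
  define C where "C = (\<Prod>i\<in>{..<q} - {j}. (y j - y i) powr \<alpha>)"
  have split: "hermite_integrand d q H u y
      = d * (pos_powr (u - y j) \<alpha> * (\<Prod>i\<in>{..<q} - {j}. pos_powr (u - y i) \<alpha>))" for u
    unfolding hermite_integrand_def \<alpha>_def[symmetric] using j by (subst prod.remove[of _ j]) auto
  have bound: "\<bar>hermite_integrand d q H u y\<bar> \<le> \<bar>d\<bar> * C * pos_powr (u - y j) \<alpha>" for u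
  proof (cases "u > y j")
    case True
    have "(\<Prod>i\<in>{..<q} - {j}. pos_powr (u - y i) \<alpha>) \<le> C"
      unfolding C_def
    proof (intro prod_mono conjI pos_powr_nonneg)
      fix i assume "i \<in> {..<q} - {j}"
      then have "y i < y j" using max by auto
      then show "pos_powr (u - y i) \<alpha> \<le> (y j - y i) powr \<alpha>"
        using True \<alpha> by (auto simp: pos_powr_def intro!: powr_mono2')
    qed
    then have "\<bar>d\<bar> * (pos_powr (u - y j) \<alpha> * (\<Prod>i\<in>{..<q} - {j}. pos_powr (u - y i) \<alpha>))
        \<le> \<bar>d\<bar> * (pos_powr (u - y j) \<alpha> * C)"
      by (intro mult_left_mono pos_powr_nonneg) auto
    then show ?thesis
      unfolding split
      by (simp add: abs_mult pos_powr_nonneg prod_nonneg abs_prod mult.commute mult.left_commute)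
  next
    case False
    then show ?thesis by (simp add: split pos_powr_def)
  qed
  have "integrable lborel (\<lambda>u. \<bar>d\<bar> * C * (indicator {0..T} u * pos_powr (u - y j) \<alpha>))"
    by (intro integrable_mult_right pos_powr_set_integrable \<alpha>)
  then show ?thesis
  proof (rule Bochner_Integration.integrable_bound)
    show "AE u in lborel. norm (indicator {0..T} u * hermite_integrand d q H u y)
        \<le> norm (\<bar>d\<bar> * C * (indicator {0..T} u * pos_powr (u - y j) \<alpha>))"
    proof (rule AE_I2)
      fix u
      show "norm (indicator {0..T} u * hermite_integrand d q H u y)
        \<le> norm (\<bar>d\<bar> * C * (indicator {0..T} u * pos_powr (u - y j) \<alpha>))"
        using order_trans[OF bound[of u] abs_ge_self] by (auto simp: indicator_def)
    qed
  qed measurable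
qed

text \<open>Each of the \<open>q\<close> factors contributes h^\<alpha>, and the factor
  \<open>h\<close> on the left is the Jacobian of u = t + h v; the exponents add up to 1 + \<alpha>
  q = H - q/2.\<close>

lemma hermite_integrand_affine:
  assumes q: "q \<ge> 1" and h: "h > 0"
  shows "h * hermite_integrand d q H (t + h * v) y
    = h powr (H - real q / 2) * hermite_integrand d q H v (affine_pow q t h y)"
proof -
  define \<alpha> where "\<alpha> = - (1/2 + (1 - H) / real q)"
  have "pos_powr (t + h * v - y i) \<alpha> = h powr \<alpha> * pos_powr (v - affine_pow q t h y i) \<alpha>" if "i < q" for i
  proof -
    have "t + h * v - y i = h * (v - affine_pow q t h y i)"
      using h that by (simp add: affine_pow_def field_simps)
    then show ?thesis by (simp add: pos_powr_mult[OF h])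
  qed
  then have "(\<Prod>i<q. pos_powr (t + h * v - y i) \<alpha>)
      = (h powr \<alpha>) ^ q * (\<Prod>i<q. pos_powr (v - affine_pow q t h y i) \<alpha>)"
    by (simp add: prod.distrib)
  moreover have "h * (h powr \<alpha>) ^ q = h powr (H - real q / 2)"
  proof -
    have "h * (h powr \<alpha>) ^ q = h powr 1 * h powr (\<alpha> * real q)"
      using h by (simp add: powr_powr[symmetric] powr_realpow)
    also have "\<dots> = h powr (1 + \<alpha> * real q)" by (simp only: powr_add)
    also have "1 + \<alpha> * real q = H - real q / 2" using q by (simp add: \<alpha>_def field_simps)
    finally show ?thesis .
  qed
  ultimately show ?thesis
    unfolding hermite_integrand_def \<alpha>_def[symmetric] by (simp add: algebra_simps)
qed

text \<open>Substituting u = t + h v in the time integral over the increment turns homogeneity of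
  the integrand into self-similarity of the kernel increments, pointwise off the diagonals.\<close>

lemma hermite_kernel_increment:
  assumes q: "q \<ge> 1" and H: "1/2 < H" "H < 1" and t: "t \<ge> 0" and h: "h > 0"
    and y: "inj_on y {..<q}"
  shows "hermite_kernel d q H (t + h) y - hermite_kernel d q H t y
    = h powr (H - real q / 2) * hermite_kernel d q H 1 (affine_pow q t h y)"
proof -
  let ?f = "\<lambda>u. hermite_integrand d q H u y"
  let ?g = "\<lambda>v. hermite_integrand d q H v (affine_pow q t h y)"
  \<comment> \<open>A divergent integral is 0 by convention, so subtracting under the integral
    requires both to converge; here the distinct coordinates enter.\<close>
  have "hermite_kernel d q H (t + h) y - hermite_kernel d q H t y
      = (\<integral>u. indicator {0..t+h} u * ?f u - indicator {0..t} u * ?f u \<partial>lborel)"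
    unfolding hermite_kernel_def set_lebesgue_integral_def real_scaleR_def
    by (intro Bochner_Integration.integral_diff[symmetric] hermite_integrand_integrable q H y)
  also have "\<dots> = (\<integral>u. indicator {t<..t+h} u * ?f u \<partial>lborel)"
    using t h by (intro Bochner_Integration.integral_cong) (auto simp: indicator_def)
  also have "\<dots> = h * (\<integral>v. indicator {t<..t+h} (t + h * v) * ?f (t + h * v) \<partial>lborel)"
    using lborel_integral_real_affine[of h "\<lambda>u. indicator {t<..t+h} u * ?f u" t] h by simp
  also have "\<dots> = (\<integral>v. indicator {0<..1} v * (h * ?f (t + h * v)) \<partial>lborel)"
    using h
    by (subst Bochner_Integration.integral_mult_right_zero[symmetric],
        intro Bochner_Integration.integral_cong)
      (auto simp: indicator_def zero_less_mult_iff mult_le_cancel_left1)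
  also have "\<dots> = (\<integral>v. h powr (H - real q / 2) * (indicator {0<..1} v * ?g v) \<partial>lborel)"
    unfolding hermite_integrand_affine[OF q h] by (simp add: mult.left_commute)
  also have "\<dots> = h powr (H - real q / 2) * (\<integral>v. indicator {0<..1} v * ?g v \<partial>lborel)"
    by simp
  also have "(\<integral>v. indicator {0<..1} v * ?g v \<partial>lborel) = (\<integral>v. indicator {0..1} v * ?g v \<partial>lborel)"
  proof (intro integral_cong_AE)
    show "AE v in lborel. indicator {0<..1} v * ?g v = indicator {0..1} v * ?g v"
      using AE_lborel_singleton[of 0] by eventually_elim (auto simp: indicator_def)
  qed measurable
  also have "\<dots> = hermite_kernel d q H 1 (affine_pow q t h y)"
    by (simp add: hermite_kernel_def set_lebesgue_integral_def)
  finally show ?thesis .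
qed

lemma elementary_fun_affine:
  assumes "h > 0"
  shows "elementary_fun q n (\<lambda>i. t + h * \<tau> i) (\<lambda>k. b * a k) y
    = b * elementary_fun q n \<tau> a (affine_pow q t h y)"
proof -
  have "indicator {t + h * r<..t + h * s} (y i)
      = (indicator {r<..s} (affine_pow q t h y i) :: real)" if "i < q" for r s i
    using assms that by (auto simp: indicator_def affine_pow_def field_simps)
  then show ?thesis
    unfolding elementary_fun_def sum_distrib_left mult.assoc
    by (intro sum.cong refl arg_cong2[where f="(*)"] prod.cong) auto
qed

text \<open>The square of h^(-q/2) cancels the Jacobian h^q of the affine change of variables, so
  rescaled translates keep their L^2 norm. Hence the approximation error is that of the kernel at
  time 1 by the elementary function, the same for all \<open>t\<close> and \<open>h\<close>.\<close>

lemma (in two_sided_brownian_motion) hermite_increment_approx: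
  fixes a :: "(nat \<Rightarrow> nat) \<Rightarrow> real"
  assumes q: "q \<ge> 1" and H: "1/2 < H" "H < 1" and Z: "hermite_process M B q H d Z"
    and t: "t \<ge> 0" and h: "h > 0" and \<tau>: "strict_mono_on {..n} \<tau>"
  defines "X \<equiv> \<lambda>\<omega>. h powr (- H) * (Z (t + h) \<omega> - Z t \<omega>)"
  defines "Y \<equiv> elementary_integral B q n (\<lambda>i. t + h * \<tau> i) (\<lambda>k. h powr (- real q / 2) * a k)"
  shows "\<exists>g. has_multiple_wiener_integral M B q g (\<lambda>\<omega>. X \<omega> - Y \<omega>) \<and>
    (\<integral>y. (g y)\<^sup>2 \<partial>lebesgue_pow q)
      = (\<integral>y. (hermite_kernel d q H 1 y - elementary_fun q n \<tau> a y)\<^sup>2 \<partial>lebesgue_pow q)"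
    and "\<exists>g. has_multiple_wiener_integral M B q g X \<and>
    (\<integral>y. (g y)\<^sup>2 \<partial>lebesgue_pow q) = (\<integral>y. (hermite_kernel d q H 1 y)\<^sup>2 \<partial>lebesgue_pow q)"
proof -
  have mwi: "has_multiple_wiener_integral M B q (hermite_kernel d q H s) (Z s)" if "s \<ge> 0" for s
    using Z that by (simp add: hermite_process_def)
  define k where "k y = h powr (- H) * hermite_kernel d q H (t + h) y
      + (- (h powr (- H))) * hermite_kernel d q H t y" for y
  have kX: "has_multiple_wiener_integral M B q k X"
    using wiener_integral_linear[OF mwi[of "t + h"] mwi[OF t], of "h powr (- H)" "- (h powr (- H))"] t h
    by (simp add: k_def[abs_def] X_def right_diff_distrib)
  define e where "e = elementary_fun q n (\<lambda>i. t + h * \<tau> i) (\<lambda>k. h powr (- real q / 2) * a k)"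
  have grid: "strict_mono_on {..n} (\<lambda>i. t + h * \<tau> i)"
    using \<tau> h by (auto simp: strict_mono_on_def)
  have keXY: "has_multiple_wiener_integral M B q (\<lambda>y. k y - e y) (\<lambda>\<omega>. X \<omega> - Y \<omega>)"
    using wiener_integral_linear[OF kX wiener_integral_elementary[OF grid], of 1 "-1"]
    by (simp add: e_def Y_def)
  \<comment> \<open>The normalisation h^(-H) meets the self-similarity exponent: -H + (H - q/2) =
    -q/2.\<close>
  have k_affine: "AE y in lebesgue_pow q.
      k y = h powr (- real q / 2) * hermite_kernel d q H 1 (affine_pow q t h y)"
    using AE_lebesgue_pow_off_diagonal
  proof eventually_elim
    case (elim y)
    have "k y = h powr (- H) * (hermite_kernel d q H (t + h) y - hermite_kernel d q H t y)"
      by (simp add: k_def right_diff_distrib)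
    then show ?case
      using hermite_kernel_increment[OF q H t h elim]
      by (simp add: mult.assoc[symmetric] powr_add[symmetric])
  qed
  have [measurable]: "k \<in> borel_measurable (lebesgue_pow q)" "e \<in> borel_measurable (lebesgue_pow q)"
    using kX elementary_fun_measurable
    by (auto simp: has_multiple_wiener_integral_def square_integrable_def e_def)
  have [measurable]: "hermite_kernel d q H 1 \<in> borel_measurable (lebesgue_pow q)"
      "elementary_fun q n \<tau> a \<in> borel_measurable (lebesgue_pow q)"
    using mwi[of 1] elementary_fun_measurable
    by (auto simp: has_multiple_wiener_integral_def square_integrable_def)
  have norm: "(\<integral>y. (u y)\<^sup>2 \<partial>lebesgue_pow q) = (\<integral>y. (w y)\<^sup>2 \<partial>lebesgue_pow q)"
    if [measurable]: "u \<in> borel_measurable (lebesgue_pow q)" "w \<in> borel_measurable (lebesgue_pow q)"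
      and AE: "AE y in lebesgue_pow q. u y = h powr (- real q / 2) * w (affine_pow q t h y)" for u w
  proof -
    have sq: "(h powr (- real q / 2))\<^sup>2 = 1 / h ^ q"
      using h by (simp add: power2_eq_square powr_add[symmetric] powr_minus powr_realpow inverse_eq_divide)
    have "AE y in lebesgue_pow q. (u y)\<^sup>2 = 1 / h ^ q * (w (affine_pow q t h y))\<^sup>2"
      using AE by eventually_elim (simp only: power_mult_distrib sq)
    then have "(\<integral>y. (u y)\<^sup>2 \<partial>lebesgue_pow q)
        = (\<integral>y. 1 / h ^ q * (w (affine_pow q t h y))\<^sup>2 \<partial>lebesgue_pow q)"
      by (intro integral_cong_AE) auto
    also have "\<dots> = (\<integral>y. (w y)\<^sup>2 \<partial>lebesgue_pow q)"
      using lebesgue_pow_integral_affine[OF h, of "\<lambda>y. (w y)\<^sup>2" q t] h by simp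
    finally show ?thesis .
  qed
  have "AE y in lebesgue_pow q. k y - e y = h powr (- real q / 2) *
      (hermite_kernel d q H 1 (affine_pow q t h y) - elementary_fun q n \<tau> a (affine_pow q t h y))"
    using k_affine
    by eventually_elim (simp add: e_def elementary_fun_affine[OF h] right_diff_distrib)
  then have "(\<integral>y. (k y - e y)\<^sup>2 \<partial>lebesgue_pow q)
      = (\<integral>y. (hermite_kernel d q H 1 y - elementary_fun q n \<tau> a y)\<^sup>2 \<partial>lebesgue_pow q)"
    by (intro norm) auto
  with keXY show "\<exists>g. has_multiple_wiener_integral M B q g (\<lambda>\<omega>. X \<omega> - Y \<omega>) \<and>
    (\<integral>y. (g y)\<^sup>2 \<partial>lebesgue_pow q)
      = (\<integral>y. (hermite_kernel d q H 1 y - elementary_fun q n \<tau> a y)\<^sup>2 \<partial>lebesgue_pow q)"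
    by blast
  show "\<exists>g. has_multiple_wiener_integral M B q g X \<and>
    (\<integral>y. (g y)\<^sup>2 \<partial>lebesgue_pow q) = (\<integral>y. (hermite_kernel d q H 1 y)\<^sup>2 \<partial>lebesgue_pow q)"
    using kX norm[OF _ _ k_affine] by (intro exI[of _ k]) auto
qed

section \<open>Laws of elementary integrals\<close>

text \<open>The map \<open>s\<close> locates the cells among the coordinates: the identity for a
  single grid, a shift for a grid placed after another one.\<close>

lemma off_diagonal_sum_measurable:
  assumes "\<And>k i. k \<in> off_diagonal q n \<Longrightarrow> i < q \<Longrightarrow> s (k i) \<in> J"
  shows "(\<lambda>x :: nat \<Rightarrow> real. (\<Sum>k\<in>off_diagonal q n. a k * (\<Prod>i<q. x (s (k i)))) ^ p)
    \<in> borel_measurable (PiM J (\<lambda>_. borel))"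
  using assms
  by (intro borel_measurable_power borel_measurable_sum borel_measurable_times borel_measurable_const
      borel_measurable_prod measurable_component_singleton) auto

context two_sided_brownian_motion
begin

text \<open>Dividing by \<open>sqrt h\<close> removes the scale from the variances, and stationarity
  removes \<open>t\<close>: the law on the right is free of both.\<close>

lemma increments_law:
  assumes \<tau>: "strict_mono_on {..n} \<tau>" and h: "h > 0" and n: "n > 0"
  shows "distr M (PiM {..<n} (\<lambda>_. borel))
      (\<lambda>\<omega>. \<lambda>j\<in>{..<n}. (B (t + h * \<tau> (Suc j)) \<omega> - B (t + h * \<tau> j) \<omega>) / sqrt h)
    = PiM {..<n} (\<lambda>j. density lborel (normal_density 0 (sqrt (\<tau> (Suc j) - \<tau> j))))"
proof -
  define \<xi> where "\<xi> j \<omega> = (B (t + h * \<tau> (Suc j)) \<omega> - B (t + h * \<tau> j) \<omega>) / sqrt h" for j \<omega>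
  have grid: "strict_mono_on {..n} (\<lambda>i. t + h * \<tau> i)"
    using \<tau> h by (auto simp: strict_mono_on_def)
  have dist: "distributed M lborel (\<xi> j) (normal_density 0 (sqrt (\<tau> (Suc j) - \<tau> j)))" if j: "j < n" for j
  proof -
    have pos: "0 < sqrt (h * (\<tau> (Suc j) - \<tau> j))"
      using grid_less[OF \<tau> j] h by simp
    have "distributed M lborel (\<lambda>\<omega>. B (t + h * \<tau> (Suc j)) \<omega> - B (t + h * \<tau> j) \<omega>)
        (normal_density 0 (sqrt (h * (\<tau> (Suc j) - \<tau> j))))"
      using increment_normal[OF grid j] by (simp add: right_diff_distrib)
    from normal_density_affine[OF this pos, of "1 / sqrt h" 0] h
    show ?thesis
      by (simp add: \<xi>_def[abs_def] real_sqrt_mult)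
  qed
  have rv: "random_variable borel (\<xi> j)" for j
    unfolding \<xi>_def[abs_def]
    by (intro borel_measurable_divide borel_measurable_diff random_variable_B borel_measurable_const)
  have "indep_vars (\<lambda>_. borel) \<xi> {..<n}"
    unfolding \<xi>_def[abs_def]
    by (rule indep_vars_compose2[OF indep_increments[OF grid], where Y="\<lambda>_ x. x / sqrt h"]) simp
  then have "distr M (PiM {..<n} (\<lambda>_. borel)) (\<lambda>\<omega>. \<lambda>j\<in>{..<n}. \<xi> j \<omega>)
      = PiM {..<n} (\<lambda>j. distr M borel (\<xi> j))"
    using n rv by (subst (asm) indep_vars_iff_distr_eq_PiM') auto
  also have "\<dots> = PiM {..<n} (\<lambda>j. density lborel (normal_density 0 (sqrt (\<tau> (Suc j) - \<tau> j))))"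
  proof (rule PiM_cong[OF refl])
    fix j assume "j \<in> {..<n}"
    then have "distr M lborel (\<xi> j) = density lborel (normal_density 0 (sqrt (\<tau> (Suc j) - \<tau> j)))"
      by (intro distributed_distr_eq_density dist) simp
    moreover have "distr M borel (\<xi> j) = distr M lborel (\<xi> j)" by (rule distr_cong) simp_all
    ultimately show "distr M borel (\<xi> j) = density lborel (normal_density 0 (sqrt (\<tau> (Suc j) - \<tau> j)))"
      by simp
  qed
  finally show ?thesis by (simp add: \<xi>_def)
qed

text \<open>The coefficient h^(-q/2) supplies one factor 1/sqrt(h) per increment, so the integral is
  a fixed polynomial in the normalised increments, whose joint law depends on neither
  \<open>t\<close> nor \<open>h\<close>.\<close>

lemma elementary_integral_affine_moment:
  assumes q: "q \<ge> 1" and \<tau>: "strict_mono_on {..n} \<tau>" and h: "h > 0"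
  shows "expectation (\<lambda>\<omega>. elementary_integral B q n (\<lambda>i. t + h * \<tau> i)
      (\<lambda>k. h powr (- real q / 2) * a k) \<omega> ^ p)
    = expectation (\<lambda>\<omega>. elementary_integral B q n \<tau> a \<omega> ^ p)"
proof (cases "n = 0")
  case True
  \<comment> \<open>A grid with a single point has no cells, and \<open>q \<ge> 1\<close> then
    leaves no multi-index: both integrals are 0.\<close>
  then have "off_diagonal q n = {}"
    using q off_diagonalD(1)[of _ q n 0] by fastforce
  then show ?thesis by (simp add: elementary_integral_def)
next
  case False
  then have n: "n > 0" by simp
  define G where "G x = (\<Sum>k\<in>off_diagonal q n. a k * (\<Prod>i<q. x (k i))) ^ p" for x :: "nat \<Rightarrow> real"
  define law where "law = PiM {..<n} (\<lambda>j. density lborel (normal_density 0 (sqrt (\<tau> (Suc j) - \<tau> j))))"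
  have G: "G \<in> borel_measurable (PiM {..<n} (\<lambda>_. borel))"
    unfolding G_def
    by (rule off_diagonal_sum_measurable[where s="\<lambda>j. j"]) (auto dest: off_diagonalD(1))
  have "expectation (\<lambda>\<omega>. elementary_integral B q n (\<lambda>i. t + h * \<tau> i)
      (\<lambda>k. h powr (- real q / 2) * a k) \<omega> ^ p) = (\<integral>x. G x \<partial>law)" if h: "h > 0" for t h
  proof -
    let ?\<xi> = "\<lambda>j \<omega>. (B (t + h * \<tau> (Suc j)) \<omega> - B (t + h * \<tau> j) \<omega>) / sqrt h"
    have "h powr (- real q / 2) = 1 / sqrt h ^ q"
      using h by (simp add: powr_minus powr_realpow[symmetric] powr_half_sqrt[symmetric] powr_powr
          inverse_eq_divide)
    moreover have "(\<Prod>i<q. (\<lambda>j\<in>{..<n}. ?\<xi> j \<omega>) (k i))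
        = (\<Prod>i<q. B (t + h * \<tau> (Suc (k i))) \<omega> - B (t + h * \<tau> (k i)) \<omega>) / sqrt h ^ q"
      if "k \<in> off_diagonal q n" for k \<omega>
    proof -
      have "(\<Prod>i<q. (\<lambda>j\<in>{..<n}. ?\<xi> j \<omega>) (k i)) = (\<Prod>i<q. ?\<xi> (k i) \<omega>)"
        using off_diagonalD(1)[OF that] by (intro prod.cong) auto
      then show ?thesis by (simp add: prod_dividef)
    qed
    ultimately have "elementary_integral B q n (\<lambda>i. t + h * \<tau> i) (\<lambda>k. h powr (- real q / 2) * a k) \<omega> ^ p
        = G (\<lambda>j\<in>{..<n}. ?\<xi> j \<omega>)" for \<omega>
      unfolding G_def elementary_integral_def
      by (intro arg_cong2[where f=power] sum.cong refl) simp
    then have "expectation (\<lambda>\<omega>. elementary_integral B q n (\<lambda>i. t + h * \<tau> i)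
        (\<lambda>k. h powr (- real q / 2) * a k) \<omega> ^ p) = expectation (\<lambda>\<omega>. G (\<lambda>j\<in>{..<n}. ?\<xi> j \<omega>))"
      by simp
    also have "\<dots> = (\<integral>x. G x \<partial>distr M (PiM {..<n} (\<lambda>_. borel)) (\<lambda>\<omega>. \<lambda>j\<in>{..<n}. ?\<xi> j \<omega>))"
      by (rule integral_distr[symmetric, OF measurable_restrict G])
        (intro borel_measurable_divide borel_measurable_diff random_variable_B borel_measurable_const)
    also have "\<dots> = (\<integral>x. G x \<partial>law)"
      unfolding law_def by (simp only: increments_law[OF \<tau> h n])
    finally show ?thesis .
  qed
  \<comment> \<open>The unscaled integral is the instance \<open>h = 1\<close>,
    \<open>t = 0\<close>.\<close>
  from this[OF h, of t] this[of 1 0] show ?thesis by simp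
qed

text \<open>The two grids are concatenated into one; each integral is then a function of its own
  block of increments, and disjoint blocks are independent.\<close>

lemma elementary_integral_uncorrelated:
  assumes \<tau>\<^sub>1: "strict_mono_on {..n\<^sub>1} \<tau>\<^sub>1" and \<tau>\<^sub>2: "strict_mono_on {..n\<^sub>2} \<tau>\<^sub>2" and sep: "\<tau>\<^sub>1 n\<^sub>1 < \<tau>\<^sub>2 0"
  shows "expectation (\<lambda>\<omega>. elementary_integral B q n\<^sub>1 \<tau>\<^sub>1 a\<^sub>1 \<omega> ^ p * elementary_integral B q n\<^sub>2 \<tau>\<^sub>2 a\<^sub>2 \<omega> ^ p)
    = expectation (\<lambda>\<omega>. elementary_integral B q n\<^sub>1 \<tau>\<^sub>1 a\<^sub>1 \<omega> ^ p) *
      expectation (\<lambda>\<omega>. elementary_integral B q n\<^sub>2 \<tau>\<^sub>2 a\<^sub>2 \<omega> ^ p)"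
proof (rule indep_var_lebesgue_integral)
  show "integrable M (\<lambda>\<omega>. elementary_integral B q n\<^sub>1 \<tau>\<^sub>1 a\<^sub>1 \<omega> ^ p)"
       "integrable M (\<lambda>\<omega>. elementary_integral B q n\<^sub>2 \<tau>\<^sub>2 a\<^sub>2 \<omega> ^ p)"
    by (intro all_moments_integrable_power elementary_integral_all_moments \<tau>\<^sub>1 \<tau>\<^sub>2)+
  define \<rho> where "\<rho> i = (if i \<le> n\<^sub>1 then \<tau>\<^sub>1 i else \<tau>\<^sub>2 (i - Suc n\<^sub>1))" for i
  have le1: "\<tau>\<^sub>1 i \<le> \<tau>\<^sub>1 n\<^sub>1" if "i \<le> n\<^sub>1" for i
    using \<tau>\<^sub>1 that by (cases "i = n\<^sub>1") (auto simp: strict_mono_on_def less_imp_le)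
  have le2: "\<tau>\<^sub>2 0 \<le> \<tau>\<^sub>2 i" if "i \<le> n\<^sub>2" for i
    using \<tau>\<^sub>2 that by (cases "i = 0") (auto simp: strict_mono_on_def less_imp_le)
  have \<rho>: "strict_mono_on {..Suc n\<^sub>1 + n\<^sub>2} \<rho>"
  proof (rule strict_mono_onI)
    fix i j assume ij: "i \<in> {..Suc n\<^sub>1 + n\<^sub>2}" "j \<in> {..Suc n\<^sub>1 + n\<^sub>2}" "i < j"
    consider "j \<le> n\<^sub>1" | "i \<le> n\<^sub>1" "n\<^sub>1 < j" | "n\<^sub>1 < i" using ij by linarith
    then show "\<rho> i < \<rho> j"
    proof cases
      case 1 then show ?thesis using ij \<tau>\<^sub>1 by (auto simp: \<rho>_def strict_mono_on_def)
    next
      case 2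
      then have "j - Suc n\<^sub>1 \<le> n\<^sub>2" using ij by auto
      then show ?thesis using 2 le1[of i] le2[of "j - Suc n\<^sub>1"] sep by (simp add: \<rho>_def)
    next
      case 3
      then have "i - Suc n\<^sub>1 < j - Suc n\<^sub>1" "j - Suc n\<^sub>1 \<le> n\<^sub>2" using ij by auto
      then show ?thesis using 3 ij \<tau>\<^sub>2 by (auto simp: \<rho>_def strict_mono_on_def)
    qed
  qed
  let ?\<xi> = "\<lambda>i \<omega>. B (\<rho> (Suc i)) \<omega> - B (\<rho> i) \<omega>"
  \<comment> \<open>Index \<open>n\<^sub>1\<close> is the gap between the two grids and belongs to
    neither block.\<close>
  let ?J = "{Suc n\<^sub>1..<Suc n\<^sub>1 + n\<^sub>2}"
  define F where "F x = (\<Sum>k\<in>off_diagonal q n\<^sub>1. a\<^sub>1 k * (\<Prod>i<q. x (k i))) ^ p" for x :: "nat \<Rightarrow> real"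
  define G where "G x = (\<Sum>k\<in>off_diagonal q n\<^sub>2. a\<^sub>2 k * (\<Prod>i<q. x (Suc n\<^sub>1 + k i))) ^ p" for x :: "nat \<Rightarrow> real"
  have "indep_var borel (F \<circ> (\<lambda>\<omega>. \<lambda>i\<in>{..<n\<^sub>1}. ?\<xi> i \<omega>)) borel (G \<circ> (\<lambda>\<omega>. \<lambda>i\<in>?J. ?\<xi> i \<omega>))"
  proof (rule indep_var_compose[OF indep_var_restrict[OF indep_increments[OF \<rho>]]])
    show "F \<in> borel_measurable (PiM {..<n\<^sub>1} (\<lambda>_. borel))"
      unfolding F_def
      by (rule off_diagonal_sum_measurable[where s="\<lambda>j. j"]) (auto dest: off_diagonalD(1))
    show "G \<in> borel_measurable (PiM ?J (\<lambda>_. borel))"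
      unfolding G_def
      by (rule off_diagonal_sum_measurable[where s="\<lambda>j. Suc n\<^sub>1 + j"]) (auto dest: off_diagonalD(1))
  qed auto
  moreover have "F (\<lambda>i\<in>{..<n\<^sub>1}. ?\<xi> i \<omega>) = elementary_integral B q n\<^sub>1 \<tau>\<^sub>1 a\<^sub>1 \<omega> ^ p" for \<omega>
    unfolding F_def elementary_integral_def
    by (intro arg_cong2[where f=power] sum.cong arg_cong2[where f="(*)"] prod.cong refl)
      (auto dest!: off_diagonalD(1) simp: \<rho>_def)
  moreover have "G (\<lambda>i\<in>?J. ?\<xi> i \<omega>) = elementary_integral B q n\<^sub>2 \<tau>\<^sub>2 a\<^sub>2 \<omega> ^ p" for \<omega>
    unfolding G_def elementary_integral_def
    by (intro arg_cong2[where f=power] sum.cong arg_cong2[where f="(*)"] prod.cong refl)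
      (auto dest!: off_diagonalD(1) simp: \<rho>_def)
  ultimately show "indep_var borel (\<lambda>\<omega>. elementary_integral B q n\<^sub>1 \<tau>\<^sub>1 a\<^sub>1 \<omega> ^ p)
      borel (\<lambda>\<omega>. elementary_integral B q n\<^sub>2 \<tau>\<^sub>2 a\<^sub>2 \<omega> ^ p)"
    by (simp add: comp_def)
qed

end

section \<open>A weak law of large numbers\<close>

text \<open>The variance of the mean is at most V / card I, and |w| <= \<delta> + w^2/\<delta>
  passes from second moments to L^1. Later \<delta> is fixed while \<open>card I\<close>
  grows.\<close>

lemma (in prob_space) uncorrelated_mean_L1:
  fixes \<delta> m V :: real
  assumes I: "finite I" "I \<noteq> {}" and \<delta>: "\<delta> > 0"
    and U: "\<And>l. l \<in> I \<Longrightarrow> all_moments M (U l)" "\<And>l. l \<in> I \<Longrightarrow> expectation (U l) = m"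
      "\<And>l. l \<in> I \<Longrightarrow> expectation (\<lambda>\<omega>. U l \<omega> ^ 2) = V"
    and uncorrelated: "\<And>l k. l \<in> I \<Longrightarrow> k \<in> I \<Longrightarrow> l \<noteq> k \<Longrightarrow> expectation (\<lambda>\<omega>. U l \<omega> * U k \<omega>) = m * m"
  shows "expectation (\<lambda>\<omega>. \<bar>(\<Sum>l\<in>I. U l \<omega>) / card I - m\<bar>) \<le> \<delta> + V / (card I * \<delta>)"
proof -
  define L where "L = real (card I)"
  have L: "L > 0" using I by (simp add: L_def card_gt_0_iff)
  define W where "W \<omega> = (\<Sum>l\<in>I. U l \<omega>) / L - m" for \<omega>
  have W_eq: "W \<omega> = (\<Sum>l\<in>I. (1 / L) * (U l \<omega> - m))" for \<omega>
    using L by (simp add: W_def sum_subtractf L_def diff_divide_distrib sum_divide_distrib)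
  have amD: "all_moments M (\<lambda>\<omega>. U l \<omega> - m)" if "l \<in> I" for l
    by (intro all_moments_diff all_moments_const U that)
  have amW: "all_moments M W"
    unfolding W_eq[abs_def] by (intro all_moments_sum all_moments_mult all_moments_const amD)
  have cov: "expectation (\<lambda>\<omega>. (U l \<omega> - m) * (U k \<omega> - m)) = (if k = l then V - m * m else 0)"
    if lk: "l \<in> I" "k \<in> I" for l k
  proof -
    have eq: "(U l \<omega> - m) * (U k \<omega> - m) = U l \<omega> * U k \<omega> + ((- m) * U l \<omega> + ((- m) * U k \<omega> + m * m))" for \<omega>
      by (simp add: algebra_simps)
    have int: "integrable M (U l)" "integrable M (U k)" "integrable M (\<lambda>\<omega>. U l \<omega> * U k \<omega>)"
      using U lk by (auto intro: all_moments_integrable all_moments_mult)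
    have "expectation (\<lambda>\<omega>. (U l \<omega> - m) * (U k \<omega> - m))
        = expectation (\<lambda>\<omega>. U l \<omega> * U k \<omega>) - m * m"
      unfolding eq using int U(2) lk by (simp add: prob_space)
    then show ?thesis using uncorrelated[OF lk] U(3)[OF lk(1)] by (auto simp: power2_eq_square)
  qed
  have "expectation (\<lambda>\<omega>. W \<omega> ^ 2)
      = expectation (\<lambda>\<omega>. \<Sum>l\<in>I. \<Sum>k\<in>I. (1 / L\<^sup>2) * ((U l \<omega> - m) * (U k \<omega> - m)))"
    unfolding W_eq power2_eq_square sum_product by (simp add: mult_ac)
  also have "\<dots> = (\<Sum>l\<in>I. \<Sum>k\<in>I. (1 / L\<^sup>2) * expectation (\<lambda>\<omega>. (U l \<omega> - m) * (U k \<omega> - m)))"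
    unfolding integral_mult_right_zero[symmetric]
    by (subst Bochner_Integration.integral_sum)
      (intro Bochner_Integration.integrable_sum sum.cong refl Bochner_Integration.integral_sum
        all_moments_integrable all_moments_mult all_moments_const amD; assumption)+
  also have "\<dots> = (\<Sum>l\<in>I. \<Sum>k\<in>I. (1 / L\<^sup>2) * (if k = l then V - m * m else 0))"
    by (intro sum.cong refl) (simp add: cov)
  also have "\<dots> = (V - m * m) / L"
    using I L by (simp add: sum.delta if_distrib L_def[symmetric] power2_eq_square cong: if_cong)
  also have "\<dots> \<le> V / L"
    using L by (intro divide_right_mono) auto
  finally have EW: "expectation (\<lambda>\<omega>. W \<omega> ^ 2) \<le> V / L" .
  have pw: "\<bar>w\<bar> \<le> \<delta> + w ^ 2 / \<delta>" for w
  proof (cases "\<bar>w\<bar> \<le> \<delta>")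
    case True then show ?thesis using \<delta> by (simp add: add_increasing2)
  next
    case False
    then have "\<bar>w\<bar> * \<delta> \<le> \<bar>w\<bar> * \<bar>w\<bar>" by (intro mult_left_mono) auto
    then have "\<bar>w\<bar> \<le> w ^ 2 / \<delta>" using \<delta> by (simp add: le_divide_eq power2_eq_square)
    then show ?thesis using \<delta> by simp
  qed
  have "expectation (\<lambda>\<omega>. \<bar>W \<omega>\<bar>) \<le> expectation (\<lambda>\<omega>. \<delta> + W \<omega> ^ 2 / \<delta>)"
    using all_moments_integrable[OF amW] all_moments_integrable_power[OF amW, of 2] pw
    by (intro integral_mono) auto
  also have "\<dots> = \<delta> + expectation (\<lambda>\<omega>. W \<omega> ^ 2) / \<delta>"
    using all_moments_integrable_power[OF amW, of 2] by (simp add: prob_space)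
  also have "\<dots> \<le> \<delta> + V / L / \<delta>"
    using EW \<delta> by (intro add_left_mono divide_right_mono) auto
  finally show ?thesis by (simp add: W_def L_def)
qed

section \<open>Convergence of the power variation\<close>

text \<open>Factor x^p - y^p, bound the cofactor by p s^(p-1), and split the product by the weighted
  arithmetic-geometric inequality. Only even powers remain, and only of \<open>x\<close> and
  \<open>x - y\<close>, the two variables whose moments are controlled by kernels.\<close>

lemma abs_power_diff_le:
  fixes x y \<epsilon> :: real
  assumes "\<epsilon> > 0" and p: "p \<ge> 1"
  shows "\<bar>x ^ p - y ^ p\<bar>
    \<le> p * ((x - y)\<^sup>2 / \<epsilon> + \<epsilon> * (16 ^ (p - 1) * (x ^ (2 * (p - 1)) + (x - y) ^ (2 * (p - 1)))))"
proof -
  define s where "s = 2 * (\<bar>x\<bar> + \<bar>x - y\<bar>)"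
  define r where "r = p - 1"
  have s: "\<bar>x\<bar> \<le> s" "\<bar>y\<bar> \<le> s" "s \<ge> 0"
    using abs_triangle_ineq4[of x "x - y"] abs_ge_zero[of x] abs_ge_zero[of "x - y"]
    unfolding s_def by (simp_all del: abs_ge_zero)
  have "\<bar>\<Sum>i<p. x ^ i * y ^ (p - Suc i)\<bar> \<le> (\<Sum>i<p. s ^ r)"
  proof (rule order_trans[OF sum_abs sum_mono])
    fix i assume i: "i \<in> {..<p}"
    have "\<bar>x ^ i * y ^ (p - Suc i)\<bar> \<le> s ^ i * s ^ (p - Suc i)"
      unfolding abs_mult power_abs using s by (intro mult_mono power_mono) auto
    also have "\<dots> = s ^ r" using i by (simp add: power_add[symmetric] r_def)
    finally show "\<bar>x ^ i * y ^ (p - Suc i)\<bar> \<le> s ^ r" .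
  qed
  then have "\<bar>x ^ p - y ^ p\<bar> \<le> \<bar>x - y\<bar> * (p * s ^ r)"
    unfolding power_diff_sumr2 abs_mult by (intro mult_left_mono) (auto simp: mult.commute)
  also have "\<dots> = p * (\<bar>x - y\<bar> * s ^ r)" by simp
  also have "\<dots> \<le> p * ((x - y)\<^sup>2 / \<epsilon> + \<epsilon> * (s ^ r)\<^sup>2)"
  proof (rule mult_left_mono)
    have "2 * (\<bar>x - y\<bar> / sqrt \<epsilon>) * (sqrt \<epsilon> * s ^ r) \<le> (\<bar>x - y\<bar> / sqrt \<epsilon>)\<^sup>2 + (sqrt \<epsilon> * s ^ r)\<^sup>2"
      by (rule sum_squares_bound)
    then have "2 * (\<bar>x - y\<bar> * s ^ r) \<le> (x - y)\<^sup>2 / \<epsilon> + \<epsilon> * (s ^ r)\<^sup>2"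
      using assms by (simp add: power_divide power_mult_distrib)
    moreover have "0 \<le> \<bar>x - y\<bar> * s ^ r" using s by simp
    ultimately show "\<bar>x - y\<bar> * s ^ r \<le> (x - y)\<^sup>2 / \<epsilon> + \<epsilon> * (s ^ r)\<^sup>2" by linarith
  qed simp
  also have "\<dots> \<le> p * ((x - y)\<^sup>2 / \<epsilon> + \<epsilon> * (16 ^ r * (x ^ (2 * r) + (x - y) ^ (2 * r))))"
  proof (intro mult_left_mono add_left_mono)
    \<comment> \<open>Since \<open>s\<close> is at most 4 times this maximum, (s^r)^2 is at most
      4^(2r) = 16^r times its power.\<close>
    let ?m = "max \<bar>x\<bar> \<bar>x - y\<bar>"
    have "(s ^ r)\<^sup>2 = s ^ (2 * r)" by (simp add: power_mult[symmetric] mult.commute)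
    also have "\<dots> \<le> (4 * ?m) ^ (2 * r)"
      using s(3) by (intro power_mono) (simp_all add: s_def max_def)
    also have "\<dots> = 16 ^ r * ?m ^ (2 * r)"
      by (simp add: power_mult_distrib power_mult)
    also have "\<dots> \<le> 16 ^ r * (x ^ (2 * r) + (x - y) ^ (2 * r))"
      by (intro mult_left_mono) (auto simp: max_def power_even_abs)
    finally show "(s ^ r)\<^sup>2 \<le> 16 ^ r * (x ^ (2 * r) + (x - y) ^ (2 * r))" .
  qed (use assms in auto)
  finally show ?thesis by (simp add: r_def)
qed

context two_sided_brownian_motion
begin

text \<open>The second moment of X - Y is of order \<epsilon>^2 and is divided by \<epsilon>; the
  other term has the factor \<epsilon> and moments bounded through \<open>K\<close> and \<epsilon>
  <= 1. As \<open>D\<close> sees the kernels only through \<open>K\<close>, one \<epsilon> works for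
  all increments at once.\<close>

lemma wiener_integral_power_stable:
  assumes p: "p \<ge> 1" and K: "K \<ge> 0"
  shows "\<exists>D\<ge>0. \<forall>\<epsilon> f g X Y. 0 < \<epsilon> \<longrightarrow> \<epsilon> \<le> 1 \<longrightarrow> all_moments M Y \<longrightarrow>
    has_multiple_wiener_integral M B q f X \<longrightarrow> (\<integral>y. (f y)\<^sup>2 \<partial>lebesgue_pow q) = K \<longrightarrow>
    has_multiple_wiener_integral M B q g (\<lambda>\<omega>. X \<omega> - Y \<omega>) \<longrightarrow> (\<integral>y. (g y)\<^sup>2 \<partial>lebesgue_pow q) \<le> \<epsilon>\<^sup>2 \<longrightarrow>
    expectation (\<lambda>\<omega>. \<bar>X \<omega> ^ p - Y \<omega> ^ p\<bar>) \<le> D * \<epsilon>"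
proof -
  define r where "r = p - 1"
  obtain C\<^sub>1 where C1: "C\<^sub>1 \<ge> 0" "\<And>f X. has_multiple_wiener_integral M B q f X \<Longrightarrow>
      expectation (\<lambda>\<omega>. X \<omega> ^ (2*1)) \<le> (C\<^sub>1 * (\<integral>y. (f y)\<^sup>2 \<partial>lebesgue_pow q)) ^ 1"
    using wiener_integral_moment_le[where q=q and r=1] by blast
  obtain C\<^sub>2 where C2: "C\<^sub>2 \<ge> 0" "\<And>f X. has_multiple_wiener_integral M B q f X \<Longrightarrow>
      expectation (\<lambda>\<omega>. X \<omega> ^ (2*r)) \<le> (C\<^sub>2 * (\<integral>y. (f y)\<^sup>2 \<partial>lebesgue_pow q)) ^ r"
    using wiener_integral_moment_le[where q=q and r=r] by blast
  show ?thesis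
  proof (intro exI[of _ "p * (C\<^sub>1 + 16 ^ r * ((C\<^sub>2 * K) ^ r + C\<^sub>2 ^ r))"] conjI allI impI)
    show "p * (C\<^sub>1 + 16 ^ r * ((C\<^sub>2 * K) ^ r + C\<^sub>2 ^ r)) \<ge> 0" using C1 C2 K by simp
    fix \<epsilon> :: real and f g X Y
    assume \<epsilon>: "0 < \<epsilon>" "\<epsilon> \<le> 1" and Y: "all_moments M Y"
      and X: "has_multiple_wiener_integral M B q f X" "(\<integral>y. (f y)\<^sup>2 \<partial>lebesgue_pow q) = K"
      and XY: "has_multiple_wiener_integral M B q g (\<lambda>\<omega>. X \<omega> - Y \<omega>)"
        "(\<integral>y. (g y)\<^sup>2 \<partial>lebesgue_pow q) \<le> \<epsilon>\<^sup>2"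
    have amX: "all_moments M X" by (rule wiener_integral_all_moments[OF X(1)])
    note amXY = all_moments_diff[OF amX Y]
    have 1: "expectation (\<lambda>\<omega>. (X \<omega> - Y \<omega>)\<^sup>2) \<le> C\<^sub>1 * \<epsilon>\<^sup>2"
      using C1(2)[OF XY(1)] mult_left_mono[OF XY(2) C1(1)] by simp
    have 2: "expectation (\<lambda>\<omega>. X \<omega> ^ (2*r)) \<le> (C\<^sub>2 * K) ^ r"
      using C2(2)[OF X(1)] X(2) by simp
    have "(\<integral>y. (g y)\<^sup>2 \<partial>lebesgue_pow q) \<le> 1"
      using XY(2) \<epsilon> power_le_one[of \<epsilon> 2] by linarith
    then have "(C\<^sub>2 * (\<integral>y. (g y)\<^sup>2 \<partial>lebesgue_pow q)) ^ r \<le> C\<^sub>2 ^ r"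
      using C2(1) by (intro power_mono mult_left_le mult_nonneg_nonneg) auto
    then have 3: "expectation (\<lambda>\<omega>. (X \<omega> - Y \<omega>) ^ (2*r)) \<le> C\<^sub>2 ^ r"
      using C2(2)[OF XY(1)] by linarith
    have int: "integrable M (\<lambda>\<omega>. (X \<omega> - Y \<omega>)\<^sup>2)" "integrable M (\<lambda>\<omega>. X \<omega> ^ (2*r))"
      "integrable M (\<lambda>\<omega>. (X \<omega> - Y \<omega>) ^ (2*r))" "integrable M (\<lambda>\<omega>. X \<omega> ^ p - Y \<omega> ^ p)"
      using amX Y amXY by (auto intro: all_moments_integrable_power)
    have "expectation (\<lambda>\<omega>. \<bar>X \<omega> ^ p - Y \<omega> ^ p\<bar>) \<le> expectation (\<lambda>\<omega>. p * ((X \<omega> - Y \<omega>)\<^sup>2 / \<epsilon> +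
        \<epsilon> * (16 ^ r * (X \<omega> ^ (2*r) + (X \<omega> - Y \<omega>) ^ (2*r)))))"
      using int abs_power_diff_le[OF \<epsilon>(1) p] by (intro integral_mono) (auto simp: r_def)
    also have "\<dots> = p * (expectation (\<lambda>\<omega>. (X \<omega> - Y \<omega>)\<^sup>2) / \<epsilon> + \<epsilon> * (16 ^ r *
        (expectation (\<lambda>\<omega>. X \<omega> ^ (2*r)) + expectation (\<lambda>\<omega>. (X \<omega> - Y \<omega>) ^ (2*r)))))"
      using int by simp
    also have "\<dots> \<le> p * (C\<^sub>1 * \<epsilon>\<^sup>2 / \<epsilon> + \<epsilon> * (16 ^ r * ((C\<^sub>2 * K) ^ r + C\<^sub>2 ^ r)))"
      using 1 2 3 \<epsilon> by (intro mult_left_mono add_mono divide_right_mono) auto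
    also have "\<dots> = p * (C\<^sub>1 + 16 ^ r * ((C\<^sub>2 * K) ^ r + C\<^sub>2 ^ r)) * \<epsilon>"
      using \<epsilon> by (simp add: power2_eq_square algebra_simps)
    finally show "expectation (\<lambda>\<omega>. \<bar>X \<omega> ^ p - Y \<omega> ^ p\<bar>)
      \<le> p * (C\<^sub>1 + 16 ^ r * ((C\<^sub>2 * K) ^ r + C\<^sub>2 ^ r)) * \<epsilon>" .
  qed
qed

end

section \<open>Growth of the number of terms and of the gap ratio\<close>

lemma nat_floor_le: "x \<ge> 0 \<Longrightarrow> real (nat \<lfloor>x\<rfloor>) \<le> x"
  by linarith

lemma block_exp_tendsto:
  assumes "0 < \<gamma>"
  shows "filterlim (\<lambda>N. 2 ^ block_exp \<gamma> N :: real) at_top sequentially"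
proof (rule filterlim_at_top_mono)
  show "filterlim (\<lambda>N. 2 powr (real N powr \<gamma> - 1)) at_top sequentially"
    using assms by real_asymp
  have "2 powr (real N powr \<gamma> - 1) \<le> 2 ^ block_exp \<gamma> N" for N
  proof -
    have "real N powr \<gamma> - 1 \<le> block_exp \<gamma> N" unfolding block_exp_def by linarith
    then have "2 powr (real N powr \<gamma> - 1) \<le> 2 powr real (block_exp \<gamma> N)" by simp
    then show ?thesis by (simp add: powr_realpow)
  qed
  then show "\<forall>\<^sub>F N in sequentially. 2 powr (real N powr \<gamma> - 1) \<le> (2 ^ block_exp \<gamma> N :: real)"
    by simp
qed

text \<open>This is the ratio of the spacing of starting points to the length of an increment; N -
  N^\<gamma> tends to infinity because \<gamma> < 1. Once the ratio exceeds the length of the grid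
  of e, the scaled grids are disjoint.\<close>

lemma block_gap_tendsto:
  assumes "0 < \<gamma>" "\<gamma> < 1"
  shows "filterlim (\<lambda>N. 2 ^ N / 2 ^ block_exp \<gamma> N :: real) at_top sequentially"
proof (rule filterlim_at_top_mono)
  show "filterlim (\<lambda>N. 2 powr (real N - real N powr \<gamma>)) at_top sequentially"
    using assms by real_asymp
  have "2 powr (real N - real N powr \<gamma>) \<le> 2 ^ N / 2 ^ block_exp \<gamma> N" for N
  proof -
    have "block_exp \<gamma> N \<le> real N powr \<gamma>" unfolding block_exp_def by (simp add: nat_floor_le)
    then have "2 powr (real N - real N powr \<gamma>) \<le> 2 powr (real N - block_exp \<gamma> N)" by simp
    then show ?thesis by (simp add: powr_diff powr_realpow)
  qed
  then show "\<forall>\<^sub>F N in sequentially. 2 powr (real N - real N powr \<gamma>) \<le> (2 ^ N / 2 ^ block_exp \<gamma> N :: real)"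
    by simp
qed

text \<open>The factor 2^(pHN) is the p-th power of h^(-H) for h = 2^(-N), so it can be distributed
  as a normalisation over the increments.\<close>

lemma power_variation_as_mean:
  "power_variation \<gamma> H p Z N \<omega> =
    (\<Sum>l\<in>{1..2 ^ block_exp \<gamma> N}. ((1 / 2 ^ N) powr (- H) *
      (Z (real l / 2 ^ block_exp \<gamma> N + 1 / 2 ^ N) \<omega> - Z (real l / 2 ^ block_exp \<gamma> N) \<omega>)) ^ p)
    / 2 ^ block_exp \<gamma> N"
proof -
  have "(1 / 2 ^ N) powr (- H) = 2 powr (H * N)"
    by (simp add: powr_minus powr_divide powr_realpow[symmetric] powr_powr inverse_eq_divide mult.commute)
  then have "((1 / 2 ^ N) powr (- H)) ^ p = 2 powr (real p * H * real N)"
    by (simp add: powr_realpow[symmetric] powr_powr mult_ac)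
  then show ?thesis
    by (simp add: power_variation_def increment_def power_mult_distrib sum_distrib_left sum_divide_distrib)
qed

context two_sided_brownian_motion
begin

text \<open>Three errors add up: \<eta> for replacing normalised increments by elementary integrals,
  the law of large numbers for the latter, and \<eta> again for the distance of the means. The
  hypothesis \<open>stable\<close> packages the moment comparison so that it applies to every
  increment and to \<open>Z 1\<close> alike.\<close>

lemma power_variation_near:
  fixes a :: "(nat \<Rightarrow> nat) \<Rightarrow> real"
  assumes q: "q \<ge> 1" and H: "1/2 < H" "H < 1" and Z: "hermite_process M B q H d Z"
    and \<tau>: "strict_mono_on {..n} \<tau>" and \<delta>: "\<delta> > 0"
    and gap: "\<tau> n - \<tau> 0 < 2 ^ N / 2 ^ block_exp \<gamma> N"
    and stable: "\<And>f g X Y. all_moments M Y \<Longrightarrow> has_multiple_wiener_integral M B q f X \<Longrightarrow>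
      (\<integral>y. (f y)\<^sup>2 \<partial>lebesgue_pow q) = (\<integral>y. (hermite_kernel d q H 1 y)\<^sup>2 \<partial>lebesgue_pow q) \<Longrightarrow>
      has_multiple_wiener_integral M B q g (\<lambda>\<omega>. X \<omega> - Y \<omega>) \<Longrightarrow>
      (\<integral>y. (g y)\<^sup>2 \<partial>lebesgue_pow q)
        = (\<integral>y. (hermite_kernel d q H 1 y - elementary_fun q n \<tau> a y)\<^sup>2 \<partial>lebesgue_pow q) \<Longrightarrow>
      expectation (\<lambda>\<omega>. \<bar>X \<omega> ^ p - Y \<omega> ^ p\<bar>) \<le> \<eta>"
  shows "expectation (\<lambda>\<omega>. \<bar>power_variation \<gamma> H p Z N \<omega> - expectation (\<lambda>\<omega>. Z 1 \<omega> ^ p)\<bar>)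
    \<le> 2 * \<eta> + \<delta> +
      expectation (\<lambda>\<omega>. elementary_integral B q n \<tau> a \<omega> ^ (2 * p)) / (2 ^ block_exp \<gamma> N * \<delta>)"
proof -
  define L where "L = (2::nat) ^ block_exp \<gamma> N"
  define h where "h = 1 / (2::real) ^ N"
  define t where "t l = real l / real L" for l
  have L: "L > 0" "real L > 0" and h: "h > 0" by (simp_all add: L_def h_def)
  have t: "t l \<ge> 0" for l by (simp add: t_def)
  define X where "X l \<omega> = h powr (- H) * (Z (t l + h) \<omega> - Z (t l) \<omega>)" for l \<omega>
  define Y where "Y l = elementary_integral B q n (\<lambda>i. t l + h * \<tau> i) (\<lambda>k. h powr (- real q / 2) * a k)" for l
  define m where "m = expectation (\<lambda>\<omega>. elementary_integral B q n \<tau> a \<omega> ^ p)"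
  define V where "V = expectation (\<lambda>\<omega>. elementary_integral B q n \<tau> a \<omega> ^ (2 * p))"
  define \<mu> where "\<mu> = expectation (\<lambda>\<omega>. Z 1 \<omega> ^ p)"
  have grid: "strict_mono_on {..n} (\<lambda>i. t l + h * \<tau> i)" for l
    using \<tau> h by (auto simp: strict_mono_on_def)
  have amY: "all_moments M (Y l)" for l
    unfolding Y_def by (rule elementary_integral_all_moments[OF grid])
  have XY: "expectation (\<lambda>\<omega>. \<bar>X l \<omega> ^ p - Y l \<omega> ^ p\<bar>) \<le> \<eta>" and amX: "all_moments M (X l)" for l
  proof -
    note approx = hermite_increment_approx[OF q H Z t[of l] h \<tau>, folded X_def Y_def]
    obtain f where f: "has_multiple_wiener_integral M B q f (X l)"
      "(\<integral>y. (f y)\<^sup>2 \<partial>lebesgue_pow q) = (\<integral>y. (hermite_kernel d q H 1 y)\<^sup>2 \<partial>lebesgue_pow q)"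
      using approx(2) unfolding X_def[abs_def] by blast
    obtain g where g: "has_multiple_wiener_integral M B q g (\<lambda>\<omega>. X l \<omega> - Y l \<omega>)"
      "(\<integral>y. (g y)\<^sup>2 \<partial>lebesgue_pow q)
        = (\<integral>y. (hermite_kernel d q H 1 y - elementary_fun q n \<tau> a y)\<^sup>2 \<partial>lebesgue_pow q)"
      using approx(1)[of a] unfolding X_def[abs_def] Y_def by blast
    show "expectation (\<lambda>\<omega>. \<bar>X l \<omega> ^ p - Y l \<omega> ^ p\<bar>) \<le> \<eta>" by (rule stable[OF amY f g])
    show "all_moments M (X l)" by (rule wiener_integral_all_moments[OF f(1)])
  qed
  have Z1: "has_multiple_wiener_integral M B q (hermite_kernel d q H 1) (Z 1)"
    using Z by (simp add: hermite_process_def)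
  have amZ: "all_moments M (Z 1)" by (rule wiener_integral_all_moments[OF Z1])
  have amE: "all_moments M (elementary_integral B q n \<tau> a)"
    by (rule elementary_integral_all_moments[OF \<tau>])
  \<comment> \<open>The unscaled elementary function approximates the kernel of \<open>Z 1\<close>
    with the same error, which identifies the limit.\<close>
  have m_\<mu>: "\<bar>m - \<mu>\<bar> \<le> \<eta>"
  proof -
    have "\<bar>m - \<mu>\<bar> = \<bar>expectation (\<lambda>\<omega>. Z 1 \<omega> ^ p - elementary_integral B q n \<tau> a \<omega> ^ p)\<bar>"
      using amZ amE by (simp add: m_def \<mu>_def all_moments_integrable_power abs_minus_commute)
    also have "\<dots> \<le> expectation (\<lambda>\<omega>. \<bar>Z 1 \<omega> ^ p - elementary_integral B q n \<tau> a \<omega> ^ p\<bar>)"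
      by (rule integral_abs_bound)
    also have "\<dots> \<le> \<eta>"
      using wiener_integral_linear[OF Z1 wiener_integral_elementary[OF \<tau>], of 1 "-1"]
      by (intro stable[OF amE Z1 refl _ refl]) simp
    finally show ?thesis .
  qed
  have uncorrelated: "expectation (\<lambda>\<omega>. Y l \<omega> ^ p * Y k \<omega> ^ p) = m * m" if "l < k" for l k
  proof -
    \<comment> \<open>The scaled grid is shorter than the spacing \<open>1 / real L\<close>, so the
      earlier translate ends before the later one begins.\<close>
    have "h * (\<tau> n - \<tau> 0) < h * (2 ^ N / 2 ^ block_exp \<gamma> N)"
      using gap h by (intro mult_strict_left_mono)
    also have "\<dots> = 1 / real L" by (simp add: h_def L_def)
    also have "\<dots> \<le> t k - t l"
      using that L by (simp add: t_def diff_divide_distrib[symmetric] divide_right_mono)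
    finally have "t l + h * \<tau> n < t k + h * \<tau> 0" by (simp add: algebra_simps)
    then have "expectation (\<lambda>\<omega>. Y l \<omega> ^ p * Y k \<omega> ^ p)
        = expectation (\<lambda>\<omega>. Y l \<omega> ^ p) * expectation (\<lambda>\<omega>. Y k \<omega> ^ p)"
      unfolding Y_def by (rule elementary_integral_uncorrelated[OF grid grid])
    then show ?thesis
      unfolding Y_def m_def by (simp only: elementary_integral_affine_moment[OF q \<tau> h])
  qed
  have LLN: "expectation (\<lambda>\<omega>. \<bar>(\<Sum>l\<in>{1..L}. Y l \<omega> ^ p) / card {1..L} - m\<bar>)
      \<le> \<delta> + V / (card {1..L} * \<delta>)"
  proof (rule uncorrelated_mean_L1[where U="\<lambda>l \<omega>. Y l \<omega> ^ p"])
    show "{1..L} \<noteq> {}" using L by simp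
    fix l
    show "all_moments M (\<lambda>\<omega>. Y l \<omega> ^ p)" by (intro all_moments_power amY)
    show "expectation (\<lambda>\<omega>. Y l \<omega> ^ p) = m"
      unfolding Y_def m_def by (rule elementary_integral_affine_moment[OF q \<tau> h])
    show "expectation (\<lambda>\<omega>. (Y l \<omega> ^ p)\<^sup>2) = V"
      unfolding Y_def V_def power_mult[symmetric]
      by (subst elementary_integral_affine_moment[OF q \<tau> h]) (simp add: mult.commute)
    fix k assume "l \<noteq> k"
    then show "expectation (\<lambda>\<omega>. Y l \<omega> ^ p * Y k \<omega> ^ p) = m * m"
      using uncorrelated[of l k] uncorrelated[of k l] by (auto simp: nat_neq_iff mult.commute)
  qed (use \<delta> in auto)
  have int: "integrable M (\<lambda>\<omega>. \<bar>X l \<omega> ^ p - Y l \<omega> ^ p\<bar>)" for l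
    using amX amY by (intro integrable_abs Bochner_Integration.integrable_diff all_moments_integrable_power)
  have int_mean: "integrable M (\<lambda>\<omega>. \<bar>(\<Sum>l\<in>{1..L}. Y l \<omega> ^ p) / L - m\<bar>)"
    using amY by (intro integrable_abs Bochner_Integration.integrable_diff integrable_divide
        Bochner_Integration.integrable_sum all_moments_integrable_power) auto
  have S: "power_variation \<gamma> H p Z N \<omega> = (\<Sum>l\<in>{1..L}. X l \<omega> ^ p) / L" for \<omega>
    unfolding power_variation_as_mean X_def t_def h_def L_def by simp
  have "expectation (\<lambda>\<omega>. \<bar>power_variation \<gamma> H p Z N \<omega> - \<mu>\<bar>)
    \<le> expectation (\<lambda>\<omega>. (\<Sum>l\<in>{1..L}. \<bar>X l \<omega> ^ p - Y l \<omega> ^ p\<bar>) / L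
        + \<bar>(\<Sum>l\<in>{1..L}. Y l \<omega> ^ p) / L - m\<bar> + \<bar>m - \<mu>\<bar>)"
  proof (rule integral_mono)
    show "integrable M (\<lambda>\<omega>. \<bar>power_variation \<gamma> H p Z N \<omega> - \<mu>\<bar>)"
      unfolding S using amX
      by (intro integrable_abs Bochner_Integration.integrable_diff integrable_divide
        Bochner_Integration.integrable_sum all_moments_integrable_power) auto
    show "integrable M (\<lambda>\<omega>. (\<Sum>l\<in>{1..L}. \<bar>X l \<omega> ^ p - Y l \<omega> ^ p\<bar>) / L
        + \<bar>(\<Sum>l\<in>{1..L}. Y l \<omega> ^ p) / L - m\<bar> + \<bar>m - \<mu>\<bar>)"
      by (intro Bochner_Integration.integrable_add integrable_divide
        Bochner_Integration.integrable_sum int int_mean) simp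
    fix \<omega>
    have "power_variation \<gamma> H p Z N \<omega> - \<mu> = (\<Sum>l\<in>{1..L}. X l \<omega> ^ p - Y l \<omega> ^ p) / L
        + ((\<Sum>l\<in>{1..L}. Y l \<omega> ^ p) / L - m) + (m - \<mu>)"
      unfolding S by (simp add: sum_subtractf diff_divide_distrib)
    moreover have "\<bar>(\<Sum>l\<in>{1..L}. X l \<omega> ^ p - Y l \<omega> ^ p) / L\<bar>
        \<le> (\<Sum>l\<in>{1..L}. \<bar>X l \<omega> ^ p - Y l \<omega> ^ p\<bar>) / L"
      using L by (simp add: abs_divide divide_right_mono sum_abs)
    ultimately show "\<bar>power_variation \<gamma> H p Z N \<omega> - \<mu>\<bar> \<le> (\<Sum>l\<in>{1..L}. \<bar>X l \<omega> ^ p - Y l \<omega> ^ p\<bar>) / L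
        + \<bar>(\<Sum>l\<in>{1..L}. Y l \<omega> ^ p) / L - m\<bar> + \<bar>m - \<mu>\<bar>"
      by linarith
  qed
  also have "\<dots> = (\<Sum>l\<in>{1..L}. expectation (\<lambda>\<omega>. \<bar>X l \<omega> ^ p - Y l \<omega> ^ p\<bar>)) / L
      + expectation (\<lambda>\<omega>. \<bar>(\<Sum>l\<in>{1..L}. Y l \<omega> ^ p) / L - m\<bar>) + \<bar>m - \<mu>\<bar>"
  proof -
    have i1: "integrable M (\<lambda>\<omega>. (\<Sum>l\<in>{1..L}. \<bar>X l \<omega> ^ p - Y l \<omega> ^ p\<bar>) / L)"
      by (intro integrable_divide Bochner_Integration.integrable_sum int)
    have "expectation (\<lambda>\<omega>. (\<Sum>l\<in>{1..L}. \<bar>X l \<omega> ^ p - Y l \<omega> ^ p\<bar>) / L)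
        = (\<Sum>l\<in>{1..L}. expectation (\<lambda>\<omega>. \<bar>X l \<omega> ^ p - Y l \<omega> ^ p\<bar>)) / L"
      by (simp add: int)
    then show ?thesis
      using Bochner_Integration.integral_add[OF Bochner_Integration.integrable_add[OF i1 int_mean], of "\<lambda>_. \<bar>m - \<mu>\<bar>"]
        Bochner_Integration.integral_add[OF i1 int_mean]
      by (simp add: prob_space)
  qed
  also have "\<dots> \<le> (\<Sum>l\<in>{1..L}. \<eta>) / L + (\<delta> + V / (L * \<delta>)) + \<eta>"
    using LLN m_\<mu> L by (intro add_mono divide_right_mono sum_mono XY) auto
  also have "\<dots> = 2 * \<eta> + \<delta> + V / (L * \<delta>)" using L by simp
  finally show ?thesis by (simp add: \<mu>_def V_def L_def)
qed

lemma power_variation_integrable: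
  assumes Z: "hermite_process M B q H d Z"
  shows "integrable M (power_variation \<gamma> H p Z N)"
proof -
  have "all_moments M (Z s)" if "s \<ge> 0" for s
    using Z that wiener_integral_all_moments by (auto simp: hermite_process_def)
  then show ?thesis
    unfolding power_variation_def[abs_def] increment_def
    by (intro integrable_mult_right Bochner_Integration.integrable_sum all_moments_integrable_power
        all_moments_diff) auto
qed

lemma power_variation_tendsto:
  assumes q: "q \<ge> 1" and H: "1/2 < H" "H < 1" and Z: "hermite_process M B q H d Z"
    and \<gamma>: "0 < \<gamma>" "\<gamma> < 1" and p: "p \<ge> 1"
  shows "(\<lambda>N. expectation (\<lambda>\<omega>. \<bar>power_variation \<gamma> H p Z N \<omega> - expectation (\<lambda>\<omega>. Z 1 \<omega> ^ p)\<bar>))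
    \<longlonglongrightarrow> 0"
proof -
  define K where "K = (\<integral>y. (hermite_kernel d q H 1 y)\<^sup>2 \<partial>lebesgue_pow q)"
  have "K \<ge> 0" by (simp add: K_def)
  from wiener_integral_power_stable[OF p this, of q]
  obtain D where D: "D \<ge> 0" "\<And>\<epsilon> f g X Y. 0 < \<epsilon> \<Longrightarrow> \<epsilon> \<le> 1 \<Longrightarrow> all_moments M Y \<Longrightarrow>
    has_multiple_wiener_integral M B q f X \<Longrightarrow> (\<integral>y. (f y)\<^sup>2 \<partial>lebesgue_pow q) = K \<Longrightarrow>
    has_multiple_wiener_integral M B q g (\<lambda>\<omega>. X \<omega> - Y \<omega>) \<Longrightarrow> (\<integral>y. (g y)\<^sup>2 \<partial>lebesgue_pow q) \<le> \<epsilon>\<^sup>2 \<Longrightarrow>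
    expectation (\<lambda>\<omega>. \<bar>X \<omega> ^ p - Y \<omega> ^ p\<bar>) \<le> D * \<epsilon>"
    by blast
  have Z1: "has_multiple_wiener_integral M B q (hermite_kernel d q H 1) (Z 1)"
    using Z by (simp add: hermite_process_def)
  show ?thesis
  proof (rule tendstoI)
    fix e :: real assume e: "e > 0"
    \<comment> \<open>\<open>D + 1\<close> avoids division by zero. The budget is e/4 for
      \<open>2 * (D * \<epsilon>)\<close>, e/4 for the parameter \<delta> of the law of large
      numbers, and less than e/4 for the variance term.\<close>
    define \<epsilon> where "\<epsilon> = min 1 (e / (8 * (D + 1)))"
    have \<epsilon>: "0 < \<epsilon>" "\<epsilon> \<le> 1" using e D(1) by (auto simp: \<epsilon>_def)
    have "D * \<epsilon> \<le> D * (e / (8 * (D + 1)))"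
      using D(1) by (intro mult_left_mono) (auto simp: \<epsilon>_def)
    also have "\<dots> \<le> e / 8" using D(1) e by (simp add: field_simps)
    finally have De: "D * \<epsilon> \<le> e / 8" .
    \<comment> \<open>The approximant is chosen before \<open>N\<close>, so its grid length and the
      moment \<open>V\<close> are constants in the limits below.\<close>
    obtain n \<tau> a where nta: "\<And>m :: nat. strict_mono_on {..n m} (\<tau> m)"
      "(\<lambda>m. \<integral>y. (elementary_fun q (n m) (\<tau> m) (a m) y - hermite_kernel d q H 1 y)\<^sup>2 \<partial>lebesgue_pow q)
        \<longlonglongrightarrow> 0"
      by (rule wiener_integralE[OF Z1]) blast
    have "\<forall>\<^sub>F m in sequentially.
        (\<integral>y. (elementary_fun q (n m) (\<tau> m) (a m) y - hermite_kernel d q H 1 y)\<^sup>2 \<partial>lebesgue_pow q) < \<epsilon>\<^sup>2"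
      using nta(2) \<epsilon> by (intro order_tendstoD) auto
    then obtain i where i:
        "(\<integral>y. (elementary_fun q (n i) (\<tau> i) (a i) y - hermite_kernel d q H 1 y)\<^sup>2 \<partial>lebesgue_pow q) < \<epsilon>\<^sup>2"
      by (auto simp: eventually_sequentially)
    define V where "V = expectation (\<lambda>\<omega>. elementary_integral B q (n i) (\<tau> i) (a i) \<omega> ^ (2 * p))"
    have "((\<lambda>N. V / (2 ^ block_exp \<gamma> N * (e / 4))) \<longlongrightarrow> 0) sequentially"
      using e
      by (intro tendsto_divide_0[OF tendsto_const] filterlim_at_top_imp_at_infinity
          filterlim_at_top_mult_tendsto_pos[OF tendsto_const _ block_exp_tendsto[OF \<gamma>(1)], of "e / 4",
            unfolded mult.commute[of "e / 4"]]) auto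
    then have "\<forall>\<^sub>F N in sequentially. V / (2 ^ block_exp \<gamma> N * (e / 4)) < e / 4"
      using e by (intro order_tendstoD) auto
    moreover have "\<forall>\<^sub>F N in sequentially. \<tau> i (n i) - \<tau> i 0 < 2 ^ N / 2 ^ block_exp \<gamma> N"
      using block_gap_tendsto[OF \<gamma>] by (simp add: filterlim_at_top_dense)
    ultimately show "\<forall>\<^sub>F N in sequentially. dist (expectation (\<lambda>\<omega>. \<bar>power_variation \<gamma> H p Z N \<omega> -
        expectation (\<lambda>\<omega>. Z 1 \<omega> ^ p)\<bar>)) 0 < e"
    proof eventually_elim
      case (elim N)
      have "expectation (\<lambda>\<omega>. \<bar>power_variation \<gamma> H p Z N \<omega> - expectation (\<lambda>\<omega>. Z 1 \<omega> ^ p)\<bar>)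
          \<le> 2 * (D * \<epsilon>) + e / 4 + V / (2 ^ block_exp \<gamma> N * (e / 4))"
        unfolding V_def
      proof (rule power_variation_near[OF q H Z nta(1) _ elim(2)])
        fix f g X Y
        assume *: "all_moments M Y" "has_multiple_wiener_integral M B q f X"
          "(\<integral>y. (f y)\<^sup>2 \<partial>lebesgue_pow q) = (\<integral>y. (hermite_kernel d q H 1 y)\<^sup>2 \<partial>lebesgue_pow q)"
          "has_multiple_wiener_integral M B q g (\<lambda>\<omega>. X \<omega> - Y \<omega>)"
          "(\<integral>y. (g y)\<^sup>2 \<partial>lebesgue_pow q) = (\<integral>y. (hermite_kernel d q H 1 y
            - elementary_fun q (n i) (\<tau> i) (a i) y)\<^sup>2 \<partial>lebesgue_pow q)"
        show "expectation (\<lambda>\<omega>. \<bar>X \<omega> ^ p - Y \<omega> ^ p\<bar>) \<le> D * \<epsilon>"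
        proof (rule D(2)[OF \<epsilon> *(1,2) _ *(4)])
          show "(\<integral>y. (f y)\<^sup>2 \<partial>lebesgue_pow q) = K" using *(3) by (simp add: K_def)
          show "(\<integral>y. (g y)\<^sup>2 \<partial>lebesgue_pow q) \<le> \<epsilon>\<^sup>2"
            using i *(5) by (simp add: power2_commute)
        qed
      qed (use e in simp)
      also have "\<dots> < e" using De elim(1) e by linarith
      finally show ?case by simp
    qed
  qed
qed

end

text \<open>Integrability is part of the claim because the integral of a non-integrable function is
  0 by convention, so the limit alone would not express convergence in L^1.\<close>

theorem proposition2:
  fixes M :: "'a measure" and B Z :: "real \<Rightarrow> 'a \<Rightarrow> real"
    and q p :: nat and H \<gamma> d :: real
  assumes "q \<ge> 1" and "1/2 < H" and "H < 1"
    and "0 < \<gamma>" and "\<gamma> < 1" and "p \<ge> 2"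
    and "two_sided_brownian_motion M B"
    and "hermite_process M B q H d Z"
  shows "integrable M (\<lambda>\<omega>. Z 1 \<omega> ^ p) \<and>
    (\<forall>N\<ge>1. integrable M (power_variation \<gamma> H p Z N)) \<and>
    (\<lambda>N. \<integral>\<omega>. \<bar>power_variation \<gamma> H p Z N \<omega> - (\<integral>\<omega>'. Z 1 \<omega>' ^ p \<partial>M)\<bar> \<partial>M)
      \<longlonglongrightarrow> 0"
proof -
  interpret two_sided_brownian_motion M B by fact
  have "has_multiple_wiener_integral M B q (hermite_kernel d q H 1) (Z 1)"
    using assms(8) by (simp add: hermite_process_def)
  then have "integrable M (\<lambda>\<omega>. Z 1 \<omega> ^ p)"
    by (intro all_moments_integrable_power wiener_integral_all_moments)
  then show ?thesis
    using power_variation_integrable[OF assms(8)] power_variation_tendsto[OF assms(1-3,8,4,5)] assms(6)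
    by simp
qed

end
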